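(* Let $\Sigma$ be a closed connected surface with a cell decomposition, with set of edges $E$ and set of faces $F$, and let $D:E\to(0,\pi)$ and $\Phi:F\to(0,\infty)$ be functions. Then there exists a hyperbolic circle pattern on $\Sigma$ with intersection angle function $D$ and cone angle function $\Phi$, unique up to isometry (that is, there exists a unique radius function $r:F\to(0,\infty)$ whose hyperbolic circle pattern with intersection angle function $D$ has cone angle function $\Phi$), if and only if $$\sum_{f\in X}\tfrac12\Phi(f)<\sum_{e\in E(X)}D(e)$$ for every nonempty subset $X\subseteq F$.
   Context: The cell decomposition is finite. For $e\in E$, $f\in F$, write $e<f$ if $e$ is an edge of $f$. Each edge $e$ is adjacent to two faces $f,f'$, one on each side; if $f=f'$, then $e$ is counted twice in sums over the edges $e<f$ of $f$. For $X\subseteq F$, $E(X)=\{e\in E\mid e<f \text{ for some } f\in X\}$ is the set of edges contained in at least one of the faces in $X$. Circle pattern: given a radius function $r:F\to(0,\infty)$ and an intersection angle function $D:E\to(0,\pi)$, choose a point $O_f$ in the interior of each face $f$. If faces $f,f'$ share an edge $e$ with end points $P,Q$, realize the quadrilateral $O_fPO_{f'}Q$ as a hyperbolic quadrilateral (curvature $-1$) with $|O_fP|=|O_fQ|=r(f)$, $|O_{f'}P|=|O_{f'}Q|=r(f')$ and $\angle O_fPO_{f'}=\angle O_fQO_{f'}=\pi-D(e)$. Gluing all these quadrilaterals gives a hyperbolic structure on $\Sigma$ with cone points, in which each face $f$ has a circumcircle with center $O_f$ and radius $r(f)$, and the circumcircles of $f$ and $f'$ intersect at angle $D(e)$. This is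 called a hyperbolic circle pattern; it is determined by $r$ (given $D$). Let $\varphi(f,e)$ be the angle at $O_f$ in the hyperbolic triangle $O_fPO_{f'}$ (the triangle with two sides of lengths $r(f)=|O_fP|$ and $r(f')=|O_{f'}P|$ enclosing the angle $\pi-D(e)$). The cone angle at $O_f$ is $\Phi(f)=\sum_{e<f}2\varphi(f,e)$, and $\Phi:F\to(0,\infty)$ is the cone angle function of the circle pattern. *)

theory Defs
  imports "HOL-Analysis.Analysis" "HOL-Library.Disjoint_Sets"
begin

section \<open>Closed surfaces and cell decompositions\<close>

definition closed_connected_surface :: "'a topology \<Rightarrow> bool" where
  "closed_connected_surface S \<longleftrightarrow>
     topspace S \<noteq> {} \<and> compact_space S \<and> Hausdorff_space S \<and> connected_space S \<and>
     (\<forall>x\<in>topspace S. \<exists>U. openin S U \<and> x \<in> U \<and>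
        subtopology S U homeomorphic_space (euclidean :: complex topology))"

text \<open>The unit circle with the \<open>n\<close> corners \<open>cis (2 * pi * k / n)\<close> is regarded as the boundary of
  an \<open>n\<close>-gon; \<open>polygon_side n k\<close> is its \<open>k\<close>-th side without end points.\<close>

definition polygon_side :: "nat \<Rightarrow> nat \<Rightarrow> complex set" where
  "polygon_side n k = cis ` {2 * pi * real k / real n <..< 2 * pi * real (Suc k) / real n}"

definition is_edge_cell :: "'a topology \<Rightarrow> 'a set \<Rightarrow> 'a set \<Rightarrow> bool" where
  "is_edge_cell S V e \<longleftrightarrow> e \<subseteq> topspace S \<and>
     (\<exists>\<gamma>. continuous_map (top_of_set {0..1::real}) S \<gamma> \<and>
          homeomorphic_map (top_of_set {0<..<1::real}) (subtopology S e) \<gamma> \<and>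
          \<gamma> 0 \<in> V \<and> \<gamma> 1 \<in> V)"

text \<open>A face is an open disk whose closure is the image of a closed polygon: corners go to vertices
  and each open side goes homeomorphically onto an edge. Different corners or sides of the polygon
  may have the same image. The first alternative admits the decomposition of the sphere into one
  vertex and one face.\<close>

definition is_face_cell :: "'a topology \<Rightarrow> 'a set \<Rightarrow> 'a set set \<Rightarrow> 'a set \<Rightarrow> bool" where
  "is_face_cell S V E f \<longleftrightarrow> f \<subseteq> topspace S \<and>
     (\<exists>h. continuous_map (top_of_set (cball (0::complex) 1)) S h \<and>
          homeomorphic_map (top_of_set (ball (0::complex) 1)) (subtopology S f) h \<and>
          ((\<exists>v\<in>V. h ` sphere 0 1 = {v}) \<or>
           (\<exists>n>0. \<forall>k<n. h (cis (2 * pi * real k / real n)) \<in> V \<and>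
              (\<exists>e\<in>E. homeomorphic_map (top_of_set (polygon_side n k)) (subtopology S e) h))))"

text \<open>\<open>V\<close> is the set of vertices (as points), \<open>E\<close> the set of open edges and \<open>F\<close> the set of open
  faces (both as subsets of the surface).\<close>

definition cell_decomposition ::
  "'a topology \<Rightarrow> 'a set \<Rightarrow> 'a set set \<Rightarrow> 'a set set \<Rightarrow> bool" where
  "cell_decomposition S V E F \<longleftrightarrow>
     finite V \<and> finite E \<and> finite F \<and>
     partition_on (topspace S) ((\<lambda>v. {v}) ` V \<union> E \<union> F) \<and>
     (\<forall>e\<in>E. is_edge_cell S V e) \<and>
     (\<forall>f\<in>F. is_face_cell S V E f)"

definition is_edge_of :: "'a topology \<Rightarrow> 'a set \<Rightarrow> 'a set \<Rightarrow> bool" where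
  "is_edge_of S e f \<longleftrightarrow> e \<subseteq> S closure_of f"

definition edges_of_faces :: "'a topology \<Rightarrow> 'a set set \<Rightarrow> 'a set set \<Rightarrow> 'a set set" where
  "edges_of_faces S E X = {e\<in>E. \<exists>f\<in>X. is_edge_of S e f}"

text \<open>On a closed surface every edge has one or two adjacent faces. If \<open>f\<close> is the only one, it
  lies on both sides of the edge: then it is its own opposite face and the edge counts twice.\<close>

definition opposite_face :: "'a topology \<Rightarrow> 'a set set \<Rightarrow> 'a set \<Rightarrow> 'a set \<Rightarrow> 'a set" where
  "opposite_face S F f e =
     (if \<exists>f'\<in>F. f' \<noteq> f \<and> is_edge_of S e f'
      then (THE f'. f' \<in> F \<and> f' \<noteq> f \<and> is_edge_of S e f')
      else f)"

definition edge_multiplicity :: "'a topology \<Rightarrow> 'a set set \<Rightarrow> 'a set \<Rightarrow> 'a set \<Rightarrow> nat" where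
  "edge_multiplicity S F f e = (if opposite_face S F f e = f then 2 else 1)"


section \<open>The hyperbolic plane\<close>

text \<open>Hyperboloid model (curvature \<open>-1\<close>) in \<open>complex \<times> real\<close> with the Lorentz form of
  signature \<open>(2,1)\<close>.\<close>

type_synonym minkowski = "complex \<times> real"

definition lorentz :: "minkowski \<Rightarrow> minkowski \<Rightarrow> real" where
  "lorentz x y = fst x \<bullet> fst y - snd x * snd y"

definition hyperbolic_plane :: "minkowski set" where
  "hyperbolic_plane = {x. lorentz x x = -1 \<and> snd x > 0}"

definition hyp_dist :: "minkowski \<Rightarrow> minkowski \<Rightarrow> real" where
  "hyp_dist x y = arcosh (- lorentz x y)"

text \<open>The Lorentz-orthogonal projection of \<open>x\<close> to the tangent plane at \<open>p\<close>. For \<open>x \<noteq> p\<close> it is a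
  positive multiple of the initial velocity of the geodesic from \<open>p\<close> to \<open>x\<close>.\<close>

definition hyp_direction :: "minkowski \<Rightarrow> minkowski \<Rightarrow> minkowski" where
  "hyp_direction p x = x + lorentz x p *\<^sub>R p"

text \<open>\<open>hyp_angle x p y\<close> is the angle at \<open>p\<close> between the geodesics from \<open>p\<close> to \<open>x\<close> and to \<open>y\<close>.
  The Lorentz form is positive definite on the tangent plane at \<open>p\<close>.\<close>

definition hyp_angle :: "minkowski \<Rightarrow> minkowski \<Rightarrow> minkowski \<Rightarrow> real" where
  "hyp_angle x p y =
     (let u = hyp_direction p x; v = hyp_direction p y
      in arccos (lorentz u v / (sqrt (lorentz u u) * sqrt (lorentz v v))))"


section \<open>Hyperbolic circle patterns\<close>

text \<open>The angle at \<open>c\<close> in a hyperbolic triangle \<open>c p c'\<close> with \<open>|cp| = r\<close>, \<open>|c'p| = r'\<close>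
  and angle \<open>\<theta>\<close> at \<open>p\<close>. Such triangles exist if \<open>r, r' > 0\<close> and \<open>0 < \<theta> < pi\<close>, and all of them
  are congruent.\<close>

definition triangle_angle :: "real \<Rightarrow> real \<Rightarrow> real \<Rightarrow> real" where
  "triangle_angle r r' \<theta> =
     (THE \<phi>. \<exists>c\<in>hyperbolic_plane. \<exists>p\<in>hyperbolic_plane. \<exists>c'\<in>hyperbolic_plane.
        hyp_dist c p = r \<and> hyp_dist c' p = r' \<and> hyp_angle c p c' = \<theta> \<and> \<phi> = hyp_angle p c c')"

text \<open>The angle at the center of \<open>f\<close> in the half of the quadrilateral over the edge \<open>e\<close>, in the
  circle pattern with radii \<open>r\<close> and intersection angles \<open>D\<close>.\<close>

definition pattern_angle ::
  "'a topology \<Rightarrow> 'a set set \<Rightarrow> ('a set \<Rightarrow> real) \<Rightarrow> ('a set \<Rightarrow> real) \<Rightarrow> 'a set \<Rightarrow> 'a set \<Rightarrow> real" where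
  "pattern_angle S F D r f e = triangle_angle (r f) (r (opposite_face S F f e)) (pi - D e)"

definition cone_angle ::
  "'a topology \<Rightarrow> 'a set set \<Rightarrow> 'a set set \<Rightarrow> ('a set \<Rightarrow> real) \<Rightarrow> ('a set \<Rightarrow> real) \<Rightarrow> 'a set \<Rightarrow> real" where
  "cone_angle S E F D r f =
     (\<Sum>e | e \<in> E \<and> is_edge_of S e f.
        real (edge_multiplicity S F f e) * (2 * pattern_angle S F D r f e))"

text \<open>Given \<open>D\<close>, a circle pattern is determined up to isometry by its radius function, which is
  taken to be extensional so that it is determined by its values on \<open>F\<close>.\<close>

definition circle_pattern_radii ::
  "'a topology \<Rightarrow> 'a set set \<Rightarrow> 'a set set \<Rightarrow> ('a set \<Rightarrow> real) \<Rightarrow> ('a set \<Rightarrow> real) \<Rightarrow>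
     ('a set \<Rightarrow> real) \<Rightarrow> bool" where
  "circle_pattern_radii S E F D \<Phi> r \<longleftrightarrow>
     r \<in> F \<rightarrow>\<^sub>E {0<..} \<and> (\<forall>f\<in>F. cone_angle S E F D r f = \<Phi> f)"

end

theory Submission
  imports Defs
begin

text \<open>Put \<open>a f = tanh (r f / 2)\<close>. The angle at the center of \<open>f\<close> over an edge shared with \<open>g\<close> is
  \<open>arg (1 + (a g / a f) * cis D) - arg (1 + a f * a g * cis D)\<close>. It increases with \<open>a g\<close>
  and decreases if both are scaled up, and the two angles over an edge add up to
  \<open>D - 2 * arg (1 + a f * a g * cis D) < D\<close>. The last fact, summed over the edges of \<open>X\<close>, shows that the
  condition is necessary. Uniqueness is a maximum principle for the ratio of two solutions.
  Existence follows Perron's method: let \<open>\<alpha>\<close> be the pointwise infimum of all \<open>a\<close> whose cone angles are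
  at most \<open>\<Phi>\<close>. If \<open>\<alpha>\<close> is positive, it is a solution by minimality: decreasing
  \<open>\<alpha>\<close> at one face does not increase the other cone angles. If \<open>\<alpha>\<close> vanishes exactly on
  \<open>X \<noteq> {}\<close>, then along a sequence converging to \<open>\<alpha>\<close> the angles over each edge of \<open>X\<close> that lie in
  \<open>X\<close> add up to \<open>D\<close> in the limit, so the condition fails for \<open>X\<close>.\<close>

section \<open>Faces adjacent to an edge\<close>

lemma homeomorphic_map_image_subtopology:
  assumes "homeomorphic_map (top_of_set A) (subtopology S B) h" "B \<subseteq> topspace S"
  shows "h ` A = B" "inj_on h A"
  using homeomorphic_imp_surjective_map[OF assms(1)] homeomorphic_imp_injective_map[OF assms(1)]
    assms(2) by (auto simp: inf.absorb2)

text \<open>Measured in units of \<open>2 * pi / n\<close>, the argument of \<open>z\<close> has an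
  integral part, which is the index of the side. A vanishing fractional part means a corner.\<close>

lemma circle_corner_or_side:
  assumes z: "z \<in> sphere (0::complex) 1" and n: "n > 0"
  shows "\<exists>k<n. z = cis (2 * pi * real k / real n) \<or> z \<in> polygon_side n k"
proof -
  obtain t where t: "0 \<le> t" "t < 2 * pi" "z = cis t"
  proof (rule that)
    show "0 \<le> Arg2pi z" "Arg2pi z < 2 * pi" using Arg2pi by auto
    show "z = cis (Arg2pi z)" using z Arg2pi[of z] by (auto simp: cis_conv_exp is_Arg_def)
  qed
  define s where "s = t * real n / (2 * pi)"
  define k where "k = nat \<lfloor>s\<rfloor>"
  have s0: "s \<ge> 0" using t by (simp add: s_def)
  have ks: "real k \<le> s" "s < real k + 1" using s0 by (auto simp: k_def)
  have ts: "t = 2 * pi * s / real n" using n by (simp add: s_def)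
  have "s < real n" using t n unfolding s_def by (simp add: field_simps)
  hence kn: "k < n" using ks by linarith
  show ?thesis
  proof (cases "s = real k")
    case True
    thus ?thesis using kn t ts by blast
  next
    case False
    hence "real k < s" using ks by simp
    hence "2 * pi * real k < 2 * pi * s" "2 * pi * s < 2 * pi * real (Suc k)"
      using ks by simp_all
    hence "t \<in> {2 * pi * real k / real n <..< 2 * pi * real (Suc k) / real n}"
      using n unfolding ts by (simp only: greaterThanLessThan_iff divide_strict_right_mono of_nat_0_less_iff)
    thus ?thesis using kn t unfolding polygon_side_def by blast
  qed
qed

lemma cell_decompositionD:
  assumes "cell_decomposition S V E F"
  shows "finite E" "finite F" "\<And>e. e \<in> E \<Longrightarrow> is_edge_cell S V e" "\<And>f. f \<in> F \<Longrightarrow> is_face_cell S V E f"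
    "\<And>c. c \<in> E \<union> F \<Longrightarrow> c \<noteq> {} \<and> c \<subseteq> topspace S"
    "\<And>c d. c \<in> E \<union> F \<Longrightarrow> d \<in> (\<lambda>v. {v}) ` V \<union> E \<union> F \<Longrightarrow> c \<noteq> d \<Longrightarrow> c \<inter> d = {}"
  using assms unfolding cell_decomposition_def partition_on_def disjoint_def by auto

text \<open>The partition separates only cells that differ as sets, so a coincidence of an edge with
  a vertex has to be excluded separately. It fails because an edge is an injective image of an
  infinite interval.\<close>

lemma edge_cell_neq_singleton:
  assumes "is_edge_cell S V e" shows "e \<noteq> {v}"
proof
  assume e: "e = {v}"
  obtain \<gamma> where g: "homeomorphic_map (top_of_set {0<..<1::real}) (subtopology S e) \<gamma>" "e \<subseteq> topspace S"
    using assms unfolding is_edge_cell_def by blast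
  note i = homeomorphic_map_image_subtopology[OF g]
  have "finite {0<..<1::real}" using e i by (metis finite.emptyI finite_imageD finite_insert)
  thus False by (simp add: infinite_Ioo)
qed

text \<open>Otherwise an open disk would be homeomorphic to an open interval, against invariance of
  dimension. Disjointness of edges and faces then follows from the partition.\<close>

lemma edge_cell_neq_face_cell:
  assumes "is_edge_cell S V e" "is_face_cell S V' E f" shows "e \<noteq> f"
proof
  assume ef: "e = f"
  obtain \<gamma> where g: "homeomorphic_map (top_of_set {0<..<1::real}) (subtopology S e) \<gamma>"
    using assms unfolding is_edge_cell_def by blast
  obtain h where h: "homeomorphic_map (top_of_set (ball (0::complex) 1)) (subtopology S f) h"
    using assms unfolding is_face_cell_def by blast
  have "top_of_set (ball (0::complex) 1) homeomorphic_space top_of_set {0<..<1::real}"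
    using h g ef by (metis homeomorphic_map_imp_homeomorphic_space homeomorphic_space_sym homeomorphic_space_trans)
  then obtain q p where q: "homeomorphic_maps (top_of_set (ball (0::complex) 1)) (top_of_set {0<..<1::real}) q p"
    unfolding homeomorphic_space_def by blast
  have "continuous_on (ball 0 1) q" "inj_on q (ball 0 1)"
    using q unfolding homeomorphic_maps_def by (auto intro: inj_on_inverseI)
  hence "DIM(complex) \<le> DIM(real)"
    by (intro invariance_of_dimension[of "ball 0 1" q]) auto
  thus False by simp
qed

text \<open>The image of the closed disk is compact, hence closed, and so contains the closure of
  \<open>f\<close>. A point of \<open>e\<close> therefore comes from the closed disk. It lies
  neither in \<open>f\<close> nor in \<open>V\<close>, so it comes from an open side, and the edge
  covered by this side must be \<open>e\<close> since distinct edges are disjoint.\<close>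

lemma adjacent_face_side:
  assumes S: "Hausdorff_space S" and cd: "cell_decomposition S V E F"
    and e: "e \<in> E" and f: "f \<in> F" and ef: "is_edge_of S e f"
  obtains h n k where "n > 0" "continuous_map (top_of_set (cball (0::complex) 1)) S h"
    "homeomorphic_map (top_of_set (ball (0::complex) 1)) (subtopology S f) h"
    "homeomorphic_map (top_of_set (polygon_side n k)) (subtopology S e) h"
proof -
  note cdD = cell_decompositionD[OF cd]
  obtain h where h: "continuous_map (top_of_set (cball (0::complex) 1)) S h"
     and hb: "homeomorphic_map (top_of_set (ball (0::complex) 1)) (subtopology S f) h"
     and alt: "(\<exists>v\<in>V. h ` sphere 0 1 = {v}) \<or>
           (\<exists>n>0. \<forall>k<n. h (cis (2 * pi * real k / real n)) \<in> V \<and>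
              (\<exists>e\<in>E. homeomorphic_map (top_of_set (polygon_side n k)) (subtopology S e) h))"
    and fS: "f \<subseteq> topspace S"
    using cdD(4)[OF f] unfolding is_face_cell_def by metis
  have hf: "h ` ball 0 1 = f" using homeomorphic_map_image_subtopology[OF hb fS] by simp
  have "compactin S (h ` cball 0 1)"
    by (rule image_compactin[OF _ h]) (simp add: compactin_subtopology)
  hence "closedin S (h ` cball 0 1)" using S compactin_imp_closedin by blast
  hence "S closure_of f \<subseteq> h ` cball 0 1"
    using closure_of_minimal[of f "h ` cball 0 1" S] hf by (metis ball_subset_cball image_mono)
  hence "e \<subseteq> h ` cball 0 1" using ef unfolding is_edge_of_def by blast
  moreover obtain y where y: "y \<in> e" using cdD(5)[of e] e by auto
  ultimately obtain z where z: "z \<in> cball 0 1" "h z = y" by auto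
  have "e \<inter> f = {}"
    using cdD(6)[of e f] edge_cell_neq_face_cell[OF cdD(3)[OF e] cdD(4)[OF f]] e f by blast
  hence "z \<notin> ball 0 1" using z y hf by auto
  hence zs: "z \<in> sphere 0 1" using z by auto
  have yV: "y \<notin> V"
  proof
    assume "y \<in> V"
    hence "e \<inter> {y} = {}"
      using cdD(6)[of e "{y}"] edge_cell_neq_singleton[OF cdD(3)[OF e]] e by blast
    thus False using y by auto
  qed
  have "y \<in> h ` sphere 0 1" using zs z by blast
  hence "\<not> (\<exists>v\<in>V. h ` sphere 0 1 = {v})" using yV by (metis singletonD)
  then obtain n where n: "n > 0" and nn: "\<forall>k<n. h (cis (2 * pi * real k / real n)) \<in> V \<and>
              (\<exists>e\<in>E. homeomorphic_map (top_of_set (polygon_side n k)) (subtopology S e) h)"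
    using alt by blast
  obtain k where k: "k < n" "z = cis (2 * pi * real k / real n) \<or> z \<in> polygon_side n k"
    using circle_corner_or_side[OF zs n] by blast
  have zp: "z \<in> polygon_side n k" using k nn yV z by auto
  obtain e' where e': "e' \<in> E" "homeomorphic_map (top_of_set (polygon_side n k)) (subtopology S e') h"
    using nn k by blast
  have "y \<in> e'" using homeomorphic_map_image_subtopology(1)[OF e'(2)] cdD(5) e' zp z by auto
  hence "e' = e" using cdD(6)[of e' e] e e' y by blast
  thus ?thesis using that n h hb e' by blast
qed

section \<open>Gluing two faces along an edge\<close>

text \<open>Two closed half-disks glued along an edge form an open disk. The gluing map is written on the
  strip of all \<open>w\<close> with \<open>cis (Im w)\<close> on the first side: \<open>exp w\<close> is in the first disk for
  \<open>Re w \<le> 0\<close>, and the half \<open>Re w \<ge> 0\<close> is folded into the second disk.\<close>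

lemma two_faces_glue:
  assumes f1: "continuous_map (top_of_set (cball (0::complex) 1)) S h1"
      "homeomorphic_map (top_of_set (ball (0::complex) 1)) (subtopology S f1) h1"
      "homeomorphic_map (top_of_set (polygon_side n k)) (subtopology S e) h1"
    and f2: "continuous_map (top_of_set (cball (0::complex) 1)) S h2"
      "homeomorphic_map (top_of_set (ball (0::complex) 1)) (subtopology S f2) h2"
      "homeomorphic_map (top_of_set (polygon_side m l)) (subtopology S e) h2"
    and n: "n > 0" and sub: "e \<subseteq> topspace S" "f1 \<subseteq> topspace S" "f2 \<subseteq> topspace S"
    and disj: "e \<inter> f1 = {}" "e \<inter> f2 = {}" "f1 \<inter> f2 = {}"
  obtains U and g :: "complex \<Rightarrow> 'a" where "open U" "continuous_map (top_of_set U) S g" "inj_on g U"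
    "g ` U \<subseteq> e \<union> f1 \<union> f2" "g ` U \<inter> e \<noteq> {}"
proof -
  define A where "A = 2 * pi * real k / real n"
  define B where "B = 2 * pi * real (Suc k) / real n"
  \<comment> \<open>Equality holds for \<open>n = 1\<close>, where the side is the circle without
    one point. As the interval is open, \<open>cis\<close> is still injective on it.\<close>
  have AB: "A < B" "B - A \<le> 2 * pi" using n by (auto simp: A_def B_def field_simps)
  have side: "polygon_side n k = cis ` {A<..<B}" by (simp add: polygon_side_def A_def B_def)
  define U where "U = {w. A < Im w \<and> Im w < B}"
  have oU: "open U"
    unfolding U_def by (intro open_Collect_conj open_Collect_less continuous_intros)
  obtain h2i where h2i: "homeomorphic_maps (top_of_set (polygon_side m l)) (subtopology S e) h2 h2i"
    using f2(3) homeomorphic_map_maps by blast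
  \<comment> \<open>The attaching map: it sends a point of the first side to the point of the second
    side with the same image in \<open>e\<close>.\<close>
  define \<sigma> where "\<sigma> = h2i \<circ> h1"
  have i1: "h1 ` ball 0 1 = f1" "inj_on h1 (ball 0 1)"
       "h1 ` polygon_side n k = e" "inj_on h1 (polygon_side n k)"
    using homeomorphic_map_image_subtopology[OF f1(2)] homeomorphic_map_image_subtopology[OF f1(3)] sub
    by auto
  have i2: "h2 ` ball 0 1 = f2" "inj_on h2 (ball 0 1)"
    using homeomorphic_map_image_subtopology[OF f2(2)] sub by auto
  have "continuous_map (top_of_set (polygon_side n k)) (top_of_set (polygon_side m l)) \<sigma>"
    unfolding \<sigma>_def
    by (rule continuous_map_compose[where X' = "subtopology S e"])
       (use f1(3) h2i in \<open>auto simp: homeomorphic_imp_continuous_map homeomorphic_maps_def\<close>)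
  hence \<sigma>c: "continuous_on (polygon_side n k) \<sigma>"
    and \<sigma>r: "\<And>z. z \<in> polygon_side n k \<Longrightarrow> \<sigma> z \<in> polygon_side m l"
    by (auto simp: continuous_map_subtopology_eu)
  have \<sigma>h: "h2 (\<sigma> z) = h1 z" if "z \<in> polygon_side n k" for z
    using that h2i i1(3) sub by (auto simp: homeomorphic_maps_def \<sigma>_def)
  have norm_side: "norm z = 1" if "z \<in> polygon_side a b" for z a b
    using that by (auto simp: polygon_side_def)
  have cisU: "cis (Im w) \<in> polygon_side n k" if "w \<in> U" for w
    using that by (auto simp: side U_def)
  \<comment> \<open>The modulus is \<open>exp (- Re w)\<close>, so \<open>Re w \<ge> 0\<close> leads
    into the closed second disk and \<open>Re w = 0\<close> onto its side, where both formulas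
    agree.\<close>
  define q where "q w = complex_of_real (exp (- Re w)) * \<sigma> (cis (Im w))" for w
  have qn: "norm (q w) = exp (- Re w)" if "w \<in> U" for w
    using norm_side[OF \<sigma>r[OF cisU[OF that]]] by (simp add: q_def norm_mult)
  have qc: "continuous_on U q"
    unfolding q_def
    by (intro continuous_intros continuous_on_compose2[OF \<sigma>c] ) (auto simp: cisU)
  define g where "g w = (if Re w \<le> 0 then h1 (exp w) else h2 (q w))" for w
  have on_line: "h2 (q w) = h1 (exp w)" if "w \<in> U" "Re w = 0" for w
    using that \<sigma>h[OF cisU] by (simp add: q_def exp_eq_polar)
  have gc: "continuous_map (top_of_set U) S g"
    unfolding g_def
  proof (rule continuous_map_cases_le)
    show "continuous_map (subtopology (top_of_set U) {x \<in> topspace (top_of_set U). Re x \<le> 0}) S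
            (\<lambda>x. h1 (exp x))"
      unfolding subtopology_subtopology
      by (rule continuous_map_compose[OF _ f1(1), unfolded comp_def])
         (auto simp: continuous_map_subtopology_eu intro!: continuous_intros)
    show "continuous_map (subtopology (top_of_set U) {x \<in> topspace (top_of_set U). 0 \<le> Re x}) S
            (\<lambda>x. h2 (q x))"
      unfolding subtopology_subtopology
      by (rule continuous_map_compose[OF _ f2(1), unfolded comp_def])
         (auto simp: continuous_map_subtopology_eu qn intro!: continuous_on_subset[OF qc])
  qed (auto simp: on_line continuous_map_subtopology_eu intro!: continuous_intros)
  have g_neg: "exp w \<in> ball 0 1" "g w = h1 (exp w)" "g w \<in> f1" if "w \<in> U" "Re w < 0" for w
    using that i1(1) by (auto simp: g_def)
  have g_pos: "q w \<in> ball 0 1" "g w = h2 (q w)" "g w \<in> f2" if "w \<in> U" "Re w > 0" for w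
    using that i2(1) qn[of w] by (auto simp: g_def)
  have g_zero: "g w = h1 (cis (Im w))" "g w \<in> e" if "w \<in> U" "Re w = 0" for w
    using that i1(3) cisU[of w] by (auto simp: g_def exp_eq_polar)
  have cis_inj: "a = b" if "cis a = cis b" "a \<in> {A<..<B}" "b \<in> {A<..<B}" for a b
  proof -
    have "exp (\<i> * of_real a) = exp (\<i> * of_real b)" using that by (simp add: cis_conv_exp)
    hence "\<i> * of_real a = \<i> * of_real b"
      by (rule exp_complex_eqI[rotated]) (use that AB in auto)
    thus ?thesis by simp
  qed
  have gi: "inj_on g U"
  proof (rule inj_onI)
    fix w w' assume w: "w \<in> U" "w' \<in> U" and eq: "g w = g w'"
    \<comment> \<open>The sign of \<open>Re w\<close> is visible in the image: it decides which of
      the three disjoint cells contains \<open>g w\<close>.\<close>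
    consider "Re w < 0" "Re w' < 0" | "Re w = 0" "Re w' = 0" | "Re w > 0" "Re w' > 0"
      using g_neg(3)[of w] g_neg(3)[of w'] g_zero(2)[of w] g_zero(2)[of w'] g_pos(3)[of w]
        g_pos(3)[of w'] w eq disj by (metis disjoint_iff linorder_neqE_linordered_idom)
    thus "w = w'"
    proof cases
      case 1
      hence "exp w = exp w'" using g_neg w eq i1(2) by (metis inj_onD)
      thus ?thesis by (rule exp_complex_eqI[rotated]) (use w AB in \<open>auto simp: U_def\<close>)
    next
      case 2
      hence "cis (Im w) = cis (Im w')" using g_zero w eq i1(4) cisU by (metis inj_onD)
      hence "Im w = Im w'" by (rule cis_inj) (use w in \<open>auto simp: U_def\<close>)
      thus ?thesis using 2 by (simp add: complex_eq_iff)
    next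
      case 3
      hence qq: "q w = q w'" using g_pos w eq i2(2) by (metis inj_onD)
      hence r: "Re w = Re w'" using qn w by (metis exp_inj_iff neg_equal_iff_equal)
      hence "\<sigma> (cis (Im w)) = \<sigma> (cis (Im w'))" using qq by (simp add: q_def)
      hence "cis (Im w) = cis (Im w')" using \<sigma>h cisU w i1(4) by (metis inj_onD)
      hence "Im w = Im w'" by (rule cis_inj) (use w in \<open>auto simp: U_def\<close>)
      thus ?thesis using r by (simp add: complex_eq_iff)
    qed
  qed
  have "g ` U \<subseteq> e \<union> f1 \<union> f2"
    using g_neg(3) g_zero(2) g_pos(3) by (metis UnI1 UnI2 image_subsetI linorder_neqE_linordered_idom)
  moreover have "Complex 0 ((A + B) / 2) \<in> U" using AB by (auto simp: U_def)
  hence "g ` U \<inter> e \<noteq> {}" using g_zero(2)[of "Complex 0 ((A + B) / 2)"] by auto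
  ultimately show ?thesis using that oU gc gi by blast
qed

section \<open>Invariance of domain and the number of faces at an edge\<close>

text \<open>In a chart around \<open>x\<close> the map becomes a continuous injection from an open
  subset of the plane to the plane, which is open by invariance of domain.\<close>

lemma injective_image_nbhd:
  fixes g :: "complex \<Rightarrow> 'a"
  assumes S: "closed_connected_surface S" and U: "open U"
    and g: "continuous_map (top_of_set U) S g" "inj_on g U" and x: "x \<in> g ` U"
  obtains W where "openin S W" "x \<in> W" "W \<subseteq> g ` U"
proof -
  have gU: "g ` U \<subseteq> topspace S" using continuous_map_image_subset_topspace[OF g(1)] by simp
  obtain N where N: "openin S N" "x \<in> N"
    and hN: "subtopology S N homeomorphic_space (euclidean :: complex topology)"
    using S x gU unfolding closed_connected_surface_def by blast
  obtain c d where cd: "homeomorphic_maps (subtopology S N) (euclidean :: complex topology) c d"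
    using hN unfolding homeomorphic_space_def by blast
  have OS: "N \<subseteq> topspace S" using N openin_subset by blast
  define U' where "U' = {w \<in> U. g w \<in> N}"
  have "openin (top_of_set U) U'"
    using openin_continuous_map_preimage[OF g(1) N(1)] by (simp add: U'_def)
  hence U': "open U'" using U by (meson openin_open_trans)
  have U'U: "U' \<subseteq> U" by (auto simp: U'_def)
  have "continuous_map (top_of_set U') S g"
    using continuous_map_from_subtopology_mono[OF g(1) U'U] .
  hence "continuous_map (top_of_set U') (subtopology S N) g"
    by (auto simp: continuous_map_in_subtopology U'_def)
  hence "continuous_map (top_of_set U') euclidean (c \<circ> g)"
    by (rule continuous_map_compose) (use cd in \<open>auto simp: homeomorphic_maps_def\<close>)
  hence c1: "continuous_on U' (c \<circ> g)" by simp
  have dc: "d (c y) = y" if "y \<in> N" for y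
    using cd that OS by (auto simp: homeomorphic_maps_def)
  have "inj_on c N" using dc by (metis inj_onI)
  hence c2: "inj_on (c \<circ> g) U'"
    using g(2) by (intro comp_inj_on inj_on_subset[OF g(2) U'U]) (auto simp: U'_def inj_on_def)
  have "open ((c \<circ> g) ` U')" by (rule invariance_of_domain[OF c1 U' c2])
  moreover have "homeomorphic_map euclidean (subtopology S N) d"
    using cd by (meson homeomorphic_maps_map)
  ultimately have "openin (subtopology S N) (d ` (c \<circ> g) ` U')"
    by (meson homeomorphic_imp_open_map open_map_def open_openin)
  moreover have "d ` (c \<circ> g) ` U' = g ` U'" using dc by (force simp: U'_def)
  ultimately have "openin (subtopology S N) (g ` U')" by simp
  hence "openin S (g ` U')" using N openin_trans_full by blast
  moreover have "x \<in> g ` U'" using x N by (auto simp: U'_def)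
  ultimately show ?thesis using that U'U by blast
qed

text \<open>The disk glued from \<open>f1\<close> and \<open>f2\<close> contains a neighbourhood of
  some point \<open>x\<close> of \<open>e\<close>, and this neighbourhood lies in
  \<open>e \<union> f1 \<union> f2\<close>. Since \<open>x\<close> is in the closure of
  \<open>f3\<close>, the face \<open>f3\<close> would meet it, against disjointness.\<close>

lemma at_most_two_adjacent_faces:
  assumes S: "closed_connected_surface S" and cd: "cell_decomposition S V E F" and e: "e \<in> E"
    and f: "f1 \<in> F" "f2 \<in> F" "f3 \<in> F" "is_edge_of S e f1" "is_edge_of S e f2" "is_edge_of S e f3"
    and neq: "f1 \<noteq> f2" "f1 \<noteq> f3" "f2 \<noteq> f3"
  shows False
proof -
  note cdD = cell_decompositionD[OF cd]
  have H: "Hausdorff_space S" using S by (simp add: closed_connected_surface_def)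
  obtain h1 n k where 1: "n > 0" "continuous_map (top_of_set (cball (0::complex) 1)) S h1"
    "homeomorphic_map (top_of_set (ball (0::complex) 1)) (subtopology S f1) h1"
    "homeomorphic_map (top_of_set (polygon_side n k)) (subtopology S e) h1"
    using adjacent_face_side[OF H cd e f(1,4)] by metis
  obtain h2 m l where 2: "continuous_map (top_of_set (cball (0::complex) 1)) S h2"
    "homeomorphic_map (top_of_set (ball (0::complex) 1)) (subtopology S f2) h2"
    "homeomorphic_map (top_of_set (polygon_side m l)) (subtopology S e) h2"
    using adjacent_face_side[OF H cd e f(2,5)] by metis
  have ed: "e \<inter> f = {}" if "f \<in> F" for f
    using cdD(6)[of e f] edge_cell_neq_face_cell[OF cdD(3)[OF e] cdD(4)[OF that]] e that by blast
  have fd: "f1 \<inter> f2 = {}" "f1 \<inter> f3 = {}" "f2 \<inter> f3 = {}" using cdD(6) f neq by blast+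
  obtain U and g :: "complex \<Rightarrow> 'a" where g: "open U" "continuous_map (top_of_set U) S g" "inj_on g U"
    "g ` U \<subseteq> e \<union> f1 \<union> f2" "g ` U \<inter> e \<noteq> {}"
    using two_faces_glue[OF 1(2-4) 2 1(1)] cdD(5) e f ed fd by (metis UnCI)
  obtain x where x: "x \<in> g ` U" "x \<in> e" using g(5) by blast
  obtain W where W: "openin S W" "x \<in> W" "W \<subseteq> g ` U"
    using injective_image_nbhd[OF S g(1-3) x(1)] by metis
  have "x \<in> S closure_of f3" using x f(6) by (auto simp: is_edge_of_def)
  then obtain y where "y \<in> f3" "y \<in> W" using W unfolding in_closure_of by blast
  thus False using W g(4) ed[OF f(3)] fd by blast
qed

text \<open>As there are at most two adjacent faces, the definite description in
  \<open>opposite_face\<close> is well defined whenever it is used.\<close>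

lemma opposite_face_properties:
  assumes S: "closed_connected_surface S" and cd: "cell_decomposition S V E F" and e: "e \<in> E"
    and f: "f \<in> F" "is_edge_of S e f"
  shows "opposite_face S F f e \<in> F" "is_edge_of S e (opposite_face S F f e)"
    "\<And>g. g \<in> F \<Longrightarrow> is_edge_of S e g \<Longrightarrow> g = f \<or> g = opposite_face S F f e"
proof -
  have *: "opposite_face S F f e = g" if "g \<in> F" "g \<noteq> f" "is_edge_of S e g" for g
  proof -
    have "(THE f'. f' \<in> F \<and> f' \<noteq> f \<and> is_edge_of S e f') = g"
      using at_most_two_adjacent_faces[OF S cd e] f that by (intro the_equality) metis+
    thus ?thesis using that unfolding opposite_face_def by auto
  qed
  show "opposite_face S F f e \<in> F" "is_edge_of S e (opposite_face S F f e)"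
    using * f by (metis opposite_face_def)+
  show "g = f \<or> g = opposite_face S F f e" if "g \<in> F" "is_edge_of S e g" for g
    using * that by metis
qed

section \<open>Angles in hyperbolic triangles\<close>

lemma lorentz_commute: "lorentz x y = lorentz y x"
  by (simp add: lorentz_def inner_commute mult.commute)

lemma lorentz_add_left: "lorentz (x + y) z = lorentz x z + lorentz y z"
  and lorentz_add_right: "lorentz z (x + y) = lorentz z x + lorentz z y"
  and lorentz_scaleR_left: "lorentz (c *\<^sub>R x) z = c * lorentz x z"
  and lorentz_scaleR_right: "lorentz z (c *\<^sub>R x) = c * lorentz z x"
  by (simp_all add: lorentz_def inner_add_left inner_add_right algebra_simps)

lemmas lorentz_bilinear =
  lorentz_add_left lorentz_add_right lorentz_scaleR_left lorentz_scaleR_right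

lemma lorentz_hyp_direction:
  assumes "p \<in> hyperbolic_plane"
  shows "lorentz (hyp_direction p x) (hyp_direction p y) = lorentz x y + lorentz x p * lorentz y p"
    and "lorentz (hyp_direction p x) p = 0"
proof -
  have p: "lorentz p p = -1" using assms by (simp add: hyperbolic_plane_def)
  show "lorentz (hyp_direction p x) (hyp_direction p y) = lorentz x y + lorentz x p * lorentz y p"
    using lorentz_commute[of p y]
    by (simp add: hyp_direction_def lorentz_bilinear p algebra_simps)
  show "lorentz (hyp_direction p x) p = 0"
    by (simp add: hyp_direction_def lorentz_bilinear p)
qed

text \<open>Tangent vectors are spacelike: the Euclidean Cauchy-Schwarz inequality bounds
  \<open>snd w * snd p\<close>, and \<open>snd p\<close> squared exceeds the squared norm of
  \<open>fst p\<close> by \<open>1\<close>.\<close>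

lemma lorentz_tangent_nonneg:
  assumes p: "p \<in> hyperbolic_plane" and w: "lorentz w p = 0"
  shows "lorentz w w \<ge> 0"
proof -
  define P where "P = fst p \<bullet> fst p"
  define W where "W = fst w \<bullet> fst w"
  have P: "P \<ge> 0" "(snd p)\<^sup>2 = 1 + P"
    using p by (auto simp: P_def hyperbolic_plane_def lorentz_def power2_eq_square)
  have W: "W \<ge> 0" by (simp add: W_def)
  have "(fst w \<bullet> fst p)\<^sup>2 \<le> W * P" unfolding W_def P_def by (rule Cauchy_Schwarz_ineq)
  moreover have "fst w \<bullet> fst p = snd w * snd p" using w by (simp add: lorentz_def)
  ultimately have *: "(snd w)\<^sup>2 * (1 + P) \<le> W * P" using P by (simp add: power_mult_distrib)
  have "(snd w)\<^sup>2 \<le> W"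
  proof (cases "P = 0")
    case True
    thus ?thesis using * W by simp
  next
    case False
    have "(snd w)\<^sup>2 * P \<le> W * P" using * zero_le_power2[of "snd w"] unfolding distrib_left by linarith
    thus ?thesis using False P by simp
  qed
  thus ?thesis by (simp add: lorentz_def W_def power2_eq_square)
qed

lemma lorentz_tangent_Cauchy_Schwarz:
  assumes p: "p \<in> hyperbolic_plane" and u: "lorentz u p = 0" and v: "lorentz v p = 0"
    and pos: "lorentz v v > 0"
  shows "(lorentz u v)\<^sup>2 \<le> lorentz u u * lorentz v v"
proof -
  \<comment> \<open>The part of \<open>u\<close> orthogonal to \<open>v\<close>, multiplied by
    \<open>lorentz v v\<close> to avoid a division.\<close>
  define w where "w = lorentz v v *\<^sub>R u + (- 1 * lorentz u v) *\<^sub>R v"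
  have "lorentz w p = 0" using u v unfolding w_def lorentz_bilinear by simp
  hence "0 \<le> lorentz w w" using lorentz_tangent_nonneg p by blast
  also have "lorentz w w = lorentz v v * (lorentz u u * lorentz v v - (lorentz u v)\<^sup>2)"
    unfolding w_def lorentz_bilinear using lorentz_commute[of v u]
    by (simp add: algebra_simps power2_eq_square)
  finally show ?thesis using pos by (simp add: zero_le_mult_iff)
qed

text \<open>Undoing \<open>arcosh\<close> needs \<open>- lorentz c p \<ge> 1\<close>. The sign comes
  from the Euclidean Cauchy-Schwarz inequality, the size from the nonnegative square of the
  projection of \<open>c\<close> to the tangent plane at \<open>p\<close>.\<close>

lemma cosh_hyp_dist:
  assumes c: "c \<in> hyperbolic_plane" and p: "p \<in> hyperbolic_plane"
  shows "lorentz c p = - cosh (hyp_dist c p)"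
proof -
  have cc: "(snd c)\<^sup>2 = 1 + fst c \<bullet> fst c" "snd c > 0" and pp: "(snd p)\<^sup>2 = 1 + fst p \<bullet> fst p" "snd p > 0"
    using c p by (auto simp: hyperbolic_plane_def lorentz_def power2_eq_square)
  have "(fst c \<bullet> fst p)\<^sup>2 \<le> (fst c \<bullet> fst c) * (fst p \<bullet> fst p)" by (rule Cauchy_Schwarz_ineq)
  also have "\<dots> < (snd c * snd p)\<^sup>2" unfolding power_mult_distrib cc pp
    using inner_ge_zero[of "fst c"] inner_ge_zero[of "fst p"] by (simp add: algebra_simps add_pos_nonneg)
  finally have "fst c \<bullet> fst p < snd c * snd p"
    by (rule power2_less_imp_less) (use cc pp in simp)
  hence neg: "- lorentz c p \<ge> 0" by (simp add: lorentz_def)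
  have "0 \<le> lorentz (hyp_direction p c) (hyp_direction p c)"
    using lorentz_tangent_nonneg[OF p lorentz_hyp_direction(2)[OF p]] .
  hence "1\<^sup>2 \<le> (- lorentz c p)\<^sup>2"
    using c by (simp add: lorentz_hyp_direction(1)[OF p] hyperbolic_plane_def power2_eq_square)
  hence "1 \<le> - lorentz c p" using neg by (rule power2_le_imp_le)
  thus ?thesis by (simp add: hyp_dist_def)
qed

section \<open>Law of cosines and the angle as a function of two sides\<close>

text \<open>The hyperbolic law of cosines is used twice: at \<open>p\<close> it shows that
  \<open>k\<close> is the hyperbolic cosine of the third side, and at \<open>c\<close> it recovers
  the angle from the three sides.\<close>

lemma hyp_triangle_angle:
  assumes H: "c \<in> hyperbolic_plane" "p \<in> hyperbolic_plane" "c' \<in> hyperbolic_plane"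
    and r: "hyp_dist c p = r" "hyp_dist c' p = r'" "r > 0" "r' > 0"
    and \<theta>: "hyp_angle c p c' = \<theta>"
  defines "k \<equiv> cosh r * cosh r' - sinh r * sinh r' * cos \<theta>"
  shows "hyp_angle p c c' = arccos ((cosh r * k - cosh r') / (sinh r * sqrt (k\<^sup>2 - 1)))"
proof -
  have s: "sinh r > 0" "sinh r' > 0" using r by auto
  have l: "lorentz c p = - cosh r" "lorentz c' p = - cosh r'"
    using cosh_hyp_dist[OF H(1,2)] cosh_hyp_dist[OF H(3,2)] r by auto
  have self: "lorentz c c = -1" "lorentz p p = -1" "lorentz c' c' = -1"
    using H by (auto simp: hyperbolic_plane_def)
  let ?u = "hyp_direction p c" and ?v = "hyp_direction p c'"
  have uu: "lorentz ?u ?u = (sinh r)\<^sup>2" and vv: "lorentz ?v ?v = (sinh r')\<^sup>2"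
    using cosh_square_eq[of r] cosh_square_eq[of r']
    by (simp_all add: lorentz_hyp_direction(1)[OF H(2)] l self power2_eq_square)
  have uv: "lorentz ?u ?v = lorentz c c' + cosh r * cosh r'"
    by (simp add: lorentz_hyp_direction(1)[OF H(2)] l)
  \<comment> \<open>Cauchy-Schwarz puts the quotient into the interval from \<open>-1\<close> to
    \<open>1\<close>, where \<open>cos\<close> inverts \<open>arccos\<close>.\<close>
  have "(lorentz ?u ?v)\<^sup>2 \<le> (sinh r * sinh r')\<^sup>2"
    using lorentz_tangent_Cauchy_Schwarz[OF H(2), of ?u ?v] s
    by (simp add: lorentz_hyp_direction(2)[OF H(2)] uu vv power_mult_distrib)
  hence "\<bar>lorentz ?u ?v\<bar> \<le> sinh r * sinh r'"
    using s by (simp add: abs_le_square_iff[symmetric] abs_mult)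
  hence "\<bar>lorentz ?u ?v / (sinh r * sinh r')\<bar> \<le> 1" using s by (simp add: abs_mult)
  moreover have "\<theta> = arccos (lorentz ?u ?v / (sinh r * sinh r'))"
    using \<theta> s by (simp add: hyp_angle_def Let_def uu vv)
  ultimately have "cos \<theta> = lorentz ?u ?v / (sinh r * sinh r')"
    by (simp add: cos_arccos_abs)
  hence "sinh r * sinh r' * cos \<theta> = lorentz c c' + cosh r * cosh r'"
    using s by (simp add: uv)
  hence k: "lorentz c c' = - k" by (simp add: k_def)
  have "lorentz (hyp_direction c p) (hyp_direction c p) = (sinh r)\<^sup>2"
    using cosh_square_eq[of r]
    by (simp add: lorentz_hyp_direction(1)[OF H(1)] l self lorentz_commute[of p c] power2_eq_square)
  moreover have "lorentz (hyp_direction c c') (hyp_direction c c') = k\<^sup>2 - 1"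
    by (simp add: lorentz_hyp_direction(1)[OF H(1)] k self lorentz_commute[of c' c] power2_eq_square)
  moreover have "lorentz (hyp_direction c p) (hyp_direction c c') = cosh r * k - cosh r'"
    by (simp add: lorentz_hyp_direction(1)[OF H(1)] k l lorentz_commute[of c' c]
        lorentz_commute[of p c] lorentz_commute[of p c'])
  ultimately show ?thesis using s by (simp add: hyp_angle_def Let_def)
qed

lemma hyp_triangle_exists:
  assumes "r > 0" "r' > 0" "0 \<le> \<theta>" "\<theta> \<le> pi"
  shows "\<exists>c\<in>hyperbolic_plane. \<exists>p\<in>hyperbolic_plane. \<exists>c'\<in>hyperbolic_plane.
    hyp_dist c p = r \<and> hyp_dist c' p = r' \<and> hyp_angle c p c' = \<theta>"
proof -
  \<comment> \<open>The vertex \<open>p\<close> is the apex of the hyperboloid, so that angles at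
    \<open>p\<close> are Euclidean angles of the complex components.\<close>
  define p :: minkowski where "p = (0, 1)"
  define c :: minkowski where "c = (of_real (sinh r), cosh r)"
  define c' :: minkowski where "c' = (of_real (sinh r') * cis \<theta>, cosh r')"
  have s: "sinh r > 0" "sinh r' > 0" using assms by auto
  have n: "(sinh r' * cos \<theta>)\<^sup>2 + (sinh r' * sin \<theta>)\<^sup>2 = (sinh r')\<^sup>2"
    by (metis (no_types) distrib_left mult.right_neutral power_mult_distrib sin_cos_squared_add2)
  have H: "c \<in> hyperbolic_plane" "p \<in> hyperbolic_plane" "c' \<in> hyperbolic_plane"
    using cosh_square_eq[of r] cosh_square_eq[of r'] n
    by (auto simp: hyperbolic_plane_def lorentz_def p_def c_def c'_def inner_complex_def power2_eq_square)
  have l: "lorentz c p = - cosh r" "lorentz c' p = - cosh r'"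
    "lorentz c c' = sinh r * sinh r' * cos \<theta> - cosh r * cosh r'"
    by (auto simp: lorentz_def p_def c_def c'_def inner_complex_def)
  have self: "lorentz c c = -1" "lorentz c' c' = -1"
    using H by (auto simp: hyperbolic_plane_def)
  have "hyp_dist c p = r" "hyp_dist c' p = r'"
    using assms by (auto simp: hyp_dist_def l arcosh_cosh_real)
  moreover have "hyp_angle c p c' = \<theta>"
  proof -
    have "lorentz (hyp_direction p c) (hyp_direction p c) = (sinh r)\<^sup>2"
      "lorentz (hyp_direction p c') (hyp_direction p c') = (sinh r')\<^sup>2"
      using cosh_square_eq[of r] cosh_square_eq[of r']
      by (simp_all add: lorentz_hyp_direction(1)[OF H(2)] l self power2_eq_square)
    moreover have "lorentz (hyp_direction p c) (hyp_direction p c') = sinh r * sinh r' * cos \<theta>"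
      by (simp add: lorentz_hyp_direction(1)[OF H(2)] l)
    ultimately show ?thesis using s assms by (simp add: hyp_angle_def Let_def arccos_cos)
  qed
  ultimately show ?thesis using H by blast
qed

text \<open>Resolves the definite description: a triangle with these data exists, and its angle
  depends on the data only.\<close>

lemma triangle_angle_arccos:
  assumes "r > 0" "r' > 0" "0 \<le> \<theta>" "\<theta> \<le> pi"
  defines "k \<equiv> cosh r * cosh r' - sinh r * sinh r' * cos \<theta>"
  shows "triangle_angle r r' \<theta> = arccos ((cosh r * k - cosh r') / (sinh r * sqrt (k\<^sup>2 - 1)))"
  unfolding triangle_angle_def
proof (rule the_equality, goal_cases)
  case 1
  show ?case
    using hyp_triangle_exists[OF assms(1-4)] hyp_triangle_angle assms(1,2) unfolding k_def by metis
next
  case (2 \<phi>)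
  thus ?case using hyp_triangle_angle assms(1,2) unfolding k_def by metis
qed

section \<open>The angle in terms of half radii\<close>

text \<open>\<open>vertex_arg D t\<close> is the argument of \<open>1 + t * cis D\<close> for \<open>t \<ge> 0\<close>. With \<open>a = tanh (r / 2)\<close> and
  \<open>b = tanh (r' / 2)\<close>, the angle at \<open>c\<close> is the argument of \<open>(a + b * cis D) * (1 + a * b * cis (- D))\<close>.\<close>

definition vertex_arg :: "real \<Rightarrow> real \<Rightarrow> real" where
  "vertex_arg D t = D / 2 + arctan ((t - 1) / (t + 1) * tan (D / 2))"

definition kite_angle :: "real \<Rightarrow> real \<Rightarrow> real \<Rightarrow> real" where
  "kite_angle D a b = vertex_arg D (b / a) - vertex_arg D (a * b)"

lemma vertex_arg_0: "0 < D \<Longrightarrow> D < pi \<Longrightarrow> vertex_arg D 0 = 0"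
  by (simp add: vertex_arg_def arctan_tan arctan_minus)

lemma tan_half_pos: "0 < D \<Longrightarrow> D < pi \<Longrightarrow> tan (D / 2) > (0::real)"
  by (intro tan_gt_zero) auto

lemma vertex_arg_strict_mono:
  assumes D: "0 < D" "D < pi" and st: "0 \<le> s" "s < t"
  shows "vertex_arg D s < vertex_arg D t"
proof -
  have "(s - 1) / (s + 1) < (t - 1) / (t + 1)" using st by (simp add: divide_simps) (simp add: algebra_simps)
  hence "(s - 1) / (s + 1) * tan (D / 2) < (t - 1) / (t + 1) * tan (D / 2)"
    using tan_half_pos[OF D] by (rule mult_strict_right_mono)
  thus ?thesis by (simp add: vertex_arg_def arctan_less_iff)
qed

text \<open>Replacing \<open>t\<close> by \<open>1 / t\<close> changes the sign of
  \<open>(t - 1) / (t + 1)\<close>. Geometrically,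
  \<open>t + cis D = cis D * (1 + t * cis (- D))\<close>.\<close>

lemma vertex_arg_inverse:
  assumes "0 < t" shows "vertex_arg D (1 / t) = D - vertex_arg D t"
proof -
  have "1 / t - 1 = (1 - t) / t" "1 / t + 1 = (1 + t) / t" using assms by (simp_all add: field_simps)
  hence "(1 / t - 1) / (1 / t + 1) = (1 - t) / (1 + t)" using assms by simp
  hence "(1 / t - 1) / (1 / t + 1) = - ((t - 1) / (t + 1))"
    by (simp add: minus_divide_left add.commute)
  thus ?thesis by (simp add: vertex_arg_def arctan_minus)
qed

lemma vertex_arg_bounds:
  assumes "0 < D" "D < pi" "0 < t"
  shows "0 < vertex_arg D t" "vertex_arg D t < D"
proof -
  have "0 < vertex_arg D s" if "s > 0" for s
    using vertex_arg_strict_mono[of D 0 s] vertex_arg_0 assms that by simp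
  from this[of t] this[of "1/t"] show "0 < vertex_arg D t" "vertex_arg D t < D"
    using assms by (simp_all add: vertex_arg_inverse)
qed

lemma tendsto_vertex_arg:
  assumes "(f \<longlongrightarrow> t) G" "0 \<le> t"
  shows "((\<lambda>x. vertex_arg D (f x)) \<longlongrightarrow> vertex_arg D t) G"
  unfolding vertex_arg_def by (intro tendsto_intros assms) (use assms in auto)

text \<open>For \<open>a < 1\<close> one has \<open>a * b < b / a\<close>, so positivity is
  monotonicity of \<open>vertex_arg\<close>. The upper bound holds since the first term is below
  \<open>D\<close> and the subtracted one is positive.\<close>

lemma kite_angle_bounds:
  assumes "0 < D" "D < pi" "0 < a" "a < 1" "0 < b"
  shows "0 < kite_angle D a b" "kite_angle D a b < D"
proof -
  have "a * a < 1" using assms mult_strict_mono[of a 1 a 1] by simp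
  hence "a * b < b / a" using assms by (simp add: field_simps)
  thus "0 < kite_angle D a b"
    using vertex_arg_strict_mono[of D "a * b" "b / a"] assms by (simp add: kite_angle_def)
  show "kite_angle D a b < D"
    using vertex_arg_bounds[of D "b / a"] vertex_arg_bounds[of D "a * b"] assms
    by (simp add: kite_angle_def)
qed

text \<open>The half-argument substitutions \<open>a\<close>, \<open>b\<close>, \<open>T\<close>
  make all quantities rational. It then suffices to check that \<open>(P, Q)\<close> is a positive
  multiple of \<open>(cos \<phi>, sin \<phi>)\<close>.\<close>

lemma triangle_angle_kite:
  assumes D: "0 < D" "D < pi" and r: "r > 0" "r' > 0"
  shows "triangle_angle r r' (pi - D) = kite_angle D (tanh (r / 2)) (tanh (r' / 2))"
proof -
  define a b T where "a = tanh (r / 2)" and "b = tanh (r' / 2)" and "T = tan (D / 2)"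
  have ab: "0 < a" "a < 1" "0 < b" "b < 1"
    using r tanh_real_lt_1[of "r/2"] tanh_real_lt_1[of "r'/2"] by (auto simp: a_def b_def)
  have T: "T > 0" using tan_half_pos[OF D] by (simp add: T_def)
  have half: "sinh t = 2 * tanh (t/2) / (1 - (tanh (t/2))\<^sup>2)"
    "cosh t = (1 + (tanh (t/2))\<^sup>2) / (1 - (tanh (t/2))\<^sup>2)" for t :: real
  proof -
    have c0: "cosh (t/2) \<noteq> 0" by simp
    have "(1 - (tanh (t/2))\<^sup>2) * (cosh (t/2))\<^sup>2 = (cosh (t/2))\<^sup>2 - (sinh (t/2))\<^sup>2"
      using c0 by (simp add: tanh_def power_divide left_diff_distrib)
    hence "(1 - (tanh (t/2))\<^sup>2) * (cosh (t/2))\<^sup>2 = 1"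
      using hyperbolic_pythagoras by simp
    hence q: "1 / (1 - (tanh (t/2))\<^sup>2) = (cosh (t/2))\<^sup>2"
      by (metis eq_divide_eq mult.commute mult_zero_left zero_neq_one)
    have "sinh t = 2 * sinh (t/2) * cosh (t/2)" using sinh_double[of "t/2"] by simp
    also have "\<dots> = 2 * tanh (t/2) * (cosh (t/2))\<^sup>2"
      using c0 by (simp add: tanh_def power2_eq_square)
    finally show "sinh t = 2 * tanh (t/2) / (1 - (tanh (t/2))\<^sup>2)" unfolding q[symmetric] by simp
    have "cosh t = (cosh (t/2))\<^sup>2 + (sinh (t/2))\<^sup>2" using cosh_double[of "t/2"] by simp
    also have "\<dots> = (1 + (tanh (t/2))\<^sup>2) * (cosh (t/2))\<^sup>2"
      using c0 by (simp add: tanh_def power_divide distrib_right)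
    finally show "cosh t = (1 + (tanh (t/2))\<^sup>2) / (1 - (tanh (t/2))\<^sup>2)" unfolding q[symmetric] by simp
  qed
  have cD: "cos D = (1 - T\<^sup>2) / (1 + T\<^sup>2)" and sD: "sin D = 2 * T / (1 + T\<^sup>2)"
  proof -
    have "D / 2 \<in> {0<..<pi/2}" using D by auto
    hence c: "cos (D/2) \<noteq> 0" using cos_gt_zero[of "D/2"] by auto
    show "cos D = (1 - T\<^sup>2) / (1 + T\<^sup>2)" using cos_tan_half[OF c] by (simp add: T_def)
    show "sin D = 2 * T / (1 + T\<^sup>2)" using sin_tan_half[of "D/2"] by (simp add: T_def)
  qed
  define x y where "x = (b - a) / (b + a) * T" and "y = (1 - a * b) / (1 + a * b) * T"
  define \<phi> where "\<phi> = arctan x + arctan y"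
  have \<phi>: "\<phi> = kite_angle D a b"
  proof -
    have "b / a - 1 = (b - a) / a" "b / a + 1 = (b + a) / a" using ab by (simp_all add: field_simps)
    hence "(b / a - 1) / (b / a + 1) * T = x" using ab by (simp add: x_def)
    moreover have "(a * b - 1) / (a * b + 1) * T = - y"
      unfolding y_def mult_minus_left[symmetric] minus_divide_left by (simp add: add.commute)
    ultimately show ?thesis
      by (simp add: \<phi>_def kite_angle_def vertex_arg_def arctan_minus T_def)
  qed
  have \<phi>b: "0 < \<phi>" "\<phi> < pi" using kite_angle_bounds[OF D ab(1-3)] D \<phi> by auto
  \<comment> \<open>With \<open>\<psi>\<close> the angle of the triangle at the center and
    \<open>s\<close> the third side, these are \<open>sinh s * cos \<psi>\<close> and
    \<open>sinh s * sin \<psi>\<close>, by the laws of cosines and sines.\<close>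
  define P Q where "P = sinh r * cosh r' + cosh r * sinh r' * cos D" and "Q = sinh r' * sin D"
  have s: "sinh r > 0" "sinh r' > 0" "sin D > 0" using r D by (auto simp: sin_gt_zero)
  hence Q: "Q > 0" by (simp add: Q_def)
  have PQ: "P * sin \<phi> = Q * cos \<phi>"
  proof -
    define w where "w = sqrt (1 + x\<^sup>2) * sqrt (1 + y\<^sup>2)"
    have sc: "sin \<phi> = (x + y) / w" "cos \<phi> = (1 - x * y) / w"
      by (simp_all add: \<phi>_def w_def sin_add cos_add sin_arctan cos_arctan add_divide_distrib diff_divide_distrib)
    have "P * (x + y) = Q * (1 - x * y)"
    proof -
      have nz: "1 - a\<^sup>2 \<noteq> 0" "1 - b\<^sup>2 \<noteq> 0" "1 + T\<^sup>2 \<noteq> 0" "b + a \<noteq> 0" "1 + a * b \<noteq> 0"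
        using ab by (auto simp: power2_eq_1_iff add_nonneg_eq_0_iff add_pos_pos[THEN less_imp_neq, symmetric])
      have "x + y = T * ((b - a) * (1 + a * b) + (1 - a * b) * (b + a)) / ((b + a) * (1 + a * b))"
        using nz by (simp add: x_def y_def field_simps)
      moreover have "x * y = T\<^sup>2 * (b - a) * (1 - a * b) / ((b + a) * (1 + a * b))"
        by (simp add: x_def y_def power2_eq_square mult_ac)
      hence "1 - x * y = ((b + a) * (1 + a * b) - T\<^sup>2 * (b - a) * (1 - a * b)) / ((b + a) * (1 + a * b))"
        using nz by (simp only: diff_divide_distrib) simp
      moreover have "P = (2 * a * (1 + b\<^sup>2) * (1 + T\<^sup>2) + (1 + a\<^sup>2) * (2 * b) * (1 - T\<^sup>2))
          / ((1 - a\<^sup>2) * (1 - b\<^sup>2) * (1 + T\<^sup>2))"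
        unfolding P_def half[of r] half[of r'] cD a_def[symmetric] b_def[symmetric]
        using nz by (simp add: divide_simps)
      moreover have "Q = 2 * b * (1 - a\<^sup>2) * (2 * T) / ((1 - a\<^sup>2) * (1 - b\<^sup>2) * (1 + T\<^sup>2))"
        unfolding Q_def half[of r'] sD b_def[symmetric]
        using nz by (simp add: divide_simps)
      moreover have "(2 * a * (1 + b\<^sup>2) * (1 + T\<^sup>2) + (1 + a\<^sup>2) * (2 * b) * (1 - T\<^sup>2)) *
          (T * ((b - a) * (1 + a * b) + (1 - a * b) * (b + a)))
        = 2 * b * (1 - a\<^sup>2) * (2 * T) * ((b + a) * (1 + a * b) - T\<^sup>2 * (b - a) * (1 - a * b))"
        by algebra
      ultimately show ?thesis by (simp only: times_divide_times_eq)
    qed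
    thus ?thesis by (simp add: sc)
  qed
  have sp: "sin \<phi> > 0" using \<phi>b by (rule sin_gt_zero)
  \<comment> \<open>The factor of proportionality. It is positive because \<open>Q\<close> and
    \<open>sin \<phi>\<close> are, which excludes the opposite direction.\<close>
  define \<rho> where "\<rho> = Q / sin \<phi>"
  have \<rho>: "\<rho> > 0" using Q sp by (simp add: \<rho>_def)
  have Q\<rho>: "Q = \<rho> * sin \<phi>" using sp by (simp add: \<rho>_def)
  have P\<rho>: "P = \<rho> * cos \<phi>" using sp PQ by (simp add: \<rho>_def eq_divide_eq)
  have "P\<^sup>2 + Q\<^sup>2 = \<rho>\<^sup>2 * ((cos \<phi>)\<^sup>2 + (sin \<phi>)\<^sup>2)"
    unfolding P\<rho> Q\<rho> by (simp only: power_mult_distrib distrib_left)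
  hence sq: "sqrt (P\<^sup>2 + Q\<^sup>2) = \<rho>" using \<rho> by simp
  define k where "k = cosh r * cosh r' - sinh r * sinh r' * cos (pi - D)"
  have k: "k = cosh r * cosh r' + sinh r * sinh r' * cos D" by (simp add: k_def)
  have k1: "cosh r * k - cosh r' = sinh r * P"
  proof -
    have "cosh r * k - cosh r' = ((cosh r)\<^sup>2 - 1) * cosh r' + sinh r * cosh r * sinh r' * cos D"
      by (simp add: k power2_eq_square algebra_simps)
    thus ?thesis unfolding cosh_square_eq by (simp add: P_def power2_eq_square algebra_simps)
  qed
  have k2: "k\<^sup>2 - 1 = P\<^sup>2 + Q\<^sup>2"
  proof -
    have "k\<^sup>2 - 1 - (P\<^sup>2 + Q\<^sup>2) = ((cosh r)\<^sup>2 - (sinh r)\<^sup>2) * ((cosh r')\<^sup>2 - (sinh r')\<^sup>2 * (cos D)\<^sup>2)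
        - (sinh r')\<^sup>2 * (sin D)\<^sup>2 - 1"
      unfolding k P_def Q_def by (simp add: power2_eq_square algebra_simps)
    also have "\<dots> = ((cosh r')\<^sup>2 - (sinh r')\<^sup>2) - 1"
      unfolding hyperbolic_pythagoras[of r] sin_squared_eq by (simp add: algebra_simps)
    finally show ?thesis by (simp add: hyperbolic_pythagoras)
  qed
  have "triangle_angle r r' (pi - D) = arccos ((cosh r * k - cosh r') / (sinh r * sqrt (k\<^sup>2 - 1)))"
    unfolding k_def using triangle_angle_arccos[of r r' "pi - D"] r D by simp
  also have "\<dots> = arccos (cos \<phi>)" unfolding k1 k2 sq using s(1) \<rho> P\<rho> by simp
  also have "\<dots> = \<phi>" using \<phi>b by (simp add: arccos_cos)
  finally show ?thesis using \<phi> by (simp add: a_def b_def)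
qed

text \<open>The arguments \<open>b / a\<close> and \<open>a / b\<close> are inverse to each other,
  so their terms add up to \<open>D\<close>, while the product term occurs twice.\<close>

lemma kite_angle_add:
  assumes "0 < a" "0 < b"
  shows "kite_angle D a b + kite_angle D b a = D - 2 * vertex_arg D (a * b)"
  using vertex_arg_inverse[of "b / a" D] assms by (simp add: kite_angle_def mult.commute)

text \<open>Scaling keeps the quotient \<open>b / a\<close> and increases the product
  \<open>a * b\<close>, which enters negatively.\<close>

lemma kite_angle_scale:
  assumes "0 < D" "D < pi" "0 < a" "0 < b" "1 < l"
  shows "kite_angle D (l * a) (l * b) < kite_angle D a b"
proof -
  have "1 < l * l" using assms by (simp add: less_1_mult)
  hence "a * b < l * a * (l * b)" using assms by (simp add: algebra_simps)
  hence "vertex_arg D (a * b) < vertex_arg D (l * a * (l * b))"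
    using assms by (intro vertex_arg_strict_mono) auto
  thus ?thesis using assms by (simp add: kite_angle_def)
qed

section \<open>Monotonicity and limits of the angle\<close>

text \<open>In this form the two derivatives in the monotonicity proof below have the same numerator
  \<open>2 * a * T\<close>, and only denominators have to be compared.\<close>

lemma has_real_derivative_arctan_quotient:
  assumes "(N has_real_derivative N') (at t)" "(q has_real_derivative q') (at t)" "q t \<noteq> 0"
  shows "((\<lambda>t. arctan (N t / q t * T)) has_real_derivative
    (N' * q t - N t * q') * T / ((q t)\<^sup>2 + T\<^sup>2 * (N t)\<^sup>2)) (at t)"
proof -
  let ?X = "N t / q t * T"
  have E: "(q t)\<^sup>2 * (1 + ?X\<^sup>2) = (q t)\<^sup>2 + T\<^sup>2 * (N t)\<^sup>2"
    using assms(3) by (simp add: distrib_left power_mult_distrib power_divide)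
  have "inverse (1 + ?X\<^sup>2) * ((N' * q t - N t * q') / (q t * q t) * T) =
    (N' * q t - N t * q') * T / ((q t)\<^sup>2 + T\<^sup>2 * (N t)\<^sup>2)"
    unfolding E[symmetric] by (simp add: divide_inverse power2_eq_square mult_ac)
  thus ?thesis
    using DERIV_chain2[OF DERIV_arctan DERIV_cmult_right[OF DERIV_divide[OF assms]], of T] by (simp only:)
qed

text \<open>The derivative in the second radius is positive: for \<open>a\<close> and
  \<open>t\<close> in the open unit interval, \<open>t + a < a * t + 1\<close> and
  \<open>\<bar>t - a\<bar> \<le> \<bar>a * t - 1\<bar>\<close>, so the first denominator is the
  smaller one.\<close>

lemma kite_angle_mono:
  assumes D: "0 < D" "D < pi" and a: "0 < a" "a < 1" and b: "0 < b" "b \<le> b'" "b' \<le> 1"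
  shows "kite_angle D a b \<le> kite_angle D a b'"
proof (cases "b = b'")
  case False
  define T where "T = tan (D / 2)"
  have T: "T > 0" using tan_half_pos[OF D] by (simp add: T_def)
  have eq: "kite_angle D a t = arctan ((t - a) / (t + a) * T) - arctan ((a * t - 1) / (a * t + 1) * T)"
    if "t > 0" for t
  proof -
    have "t / a - 1 = (t - a) / a" "t / a + 1 = (t + a) / a" using a by (simp_all add: field_simps)
    hence "(t / a - 1) / (t / a + 1) = (t - a) / (t + a)" using a by simp
    thus ?thesis by (simp add: kite_angle_def vertex_arg_def T_def)
  qed
  let ?g = "\<lambda>t. arctan ((t - a) / (t + a) * T) - arctan ((a * t - 1) / (a * t + 1) * T)"
  have "?g b < ?g b'"
  proof (rule DERIV_pos_imp_increasing_open[where f = ?g])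
    show "b < b'" using b False by simp
    fix t assume t: "b < t" "t < b'"
    hence t01: "0 < t" "t < 1" using b by auto
    have nz: "t + a \<noteq> 0" "a * t + 1 \<noteq> 0" using t01 a by (auto simp: add_pos_pos less_imp_neq[symmetric])
    let ?d = "2 * a * T / ((t + a)\<^sup>2 + T\<^sup>2 * (t - a)\<^sup>2) - 2 * a * T / ((a * t + 1)\<^sup>2 + T\<^sup>2 * (a * t - 1)\<^sup>2)"
    have d1: "((\<lambda>t. arctan ((t - a) / (t + a) * T)) has_real_derivative
        2 * a * T / ((t + a)\<^sup>2 + T\<^sup>2 * (t - a)\<^sup>2)) (at t)"
    proof -
      have "((\<lambda>t. t - a) has_real_derivative 1) (at t)" "((\<lambda>t. t + a) has_real_derivative 1) (at t)"
        by (auto intro!: derivative_eq_intros)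
      note has_real_derivative_arctan_quotient[OF this nz(1), of T]
      moreover have "1 * (t + a) - (t - a) * 1 = 2 * a" by simp
      ultimately show ?thesis by (simp only:)
    qed
    have d2: "((\<lambda>t. arctan ((a * t - 1) / (a * t + 1) * T)) has_real_derivative
        2 * a * T / ((a * t + 1)\<^sup>2 + T\<^sup>2 * (a * t - 1)\<^sup>2)) (at t)"
    proof -
      have "((\<lambda>t. a * t - 1) has_real_derivative a) (at t)" "((\<lambda>t. a * t + 1) has_real_derivative a) (at t)"
        by (auto intro!: derivative_eq_intros)
      note has_real_derivative_arctan_quotient[OF this nz(2), of T]
      moreover have "a * (a * t + 1) - (a * t - 1) * a = 2 * a" by (simp add: algebra_simps)
      ultimately show ?thesis by (simp only:)
    qed
    have "(t + a)\<^sup>2 < (a * t + 1)\<^sup>2"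
    proof (rule power_strict_mono)
      have "0 < (1 - a) * (1 - t)" using a t01 by simp
      thus "t + a < a * t + 1" by (simp add: algebra_simps)
    qed (use a t01 in auto)
    moreover have "(t - a)\<^sup>2 \<le> (a * t - 1)\<^sup>2"
    proof -
      have "0 < (1 - a) * (1 + t)" "0 < (1 + a) * (1 - t)" using a t01 by simp_all
      hence "\<bar>t - a\<bar> \<le> \<bar>a * t - 1\<bar>" by (simp add: algebra_simps)
      thus ?thesis by (simp add: abs_le_square_iff)
    qed
    hence "T\<^sup>2 * (t - a)\<^sup>2 \<le> T\<^sup>2 * (a * t - 1)\<^sup>2" by (intro mult_left_mono) auto
    ultimately have "(t + a)\<^sup>2 + T\<^sup>2 * (t - a)\<^sup>2 < (a * t + 1)\<^sup>2 + T\<^sup>2 * (a * t - 1)\<^sup>2" by simp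
    moreover have "0 < (t + a)\<^sup>2 + T\<^sup>2 * (t - a)\<^sup>2" using nz by (intro add_pos_nonneg) auto
    ultimately have "?d > 0" using a T by (simp add: divide_strict_left_mono)
    moreover have "(?g has_real_derivative ?d) (at t)" by (rule DERIV_diff[OF d1 d2])
    ultimately show "\<exists>y. (?g has_real_derivative y) (at t) \<and> 0 < y" by blast
  next
    have "t + a \<noteq> 0" "a * t + 1 \<noteq> 0" if "t \<in> {b..b'}" for t
      using a b that by (auto simp: add_pos_pos less_imp_neq[symmetric])
    thus "continuous_on {b..b'} ?g" by (intro continuous_intros) auto
  qed
  thus ?thesis using eq b by simp
qed simp

lemma tendsto_kite_angle:
  assumes "(f \<longlongrightarrow> a) G" "(g \<longlongrightarrow> b) G" "0 < a" "0 < b"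
  shows "((\<lambda>x. kite_angle D (f x) (g x)) \<longlongrightarrow> kite_angle D a b) G"
  unfolding kite_angle_def using assms
  by (intro tendsto_diff tendsto_vertex_arg tendsto_divide tendsto_mult) auto

text \<open>The quotient \<open>g x / f x\<close> is unbounded, so its term is rewritten with the
  inverse quotient, which tends to \<open>0\<close>.\<close>

lemma tendsto_kite_angle_left_0:
  assumes D: "0 < D" "D < pi" and f: "(f \<longlongrightarrow> 0) G" and g: "(g \<longlongrightarrow> b) G" "0 < b"
    and ev: "eventually (\<lambda>x. 0 < f x \<and> 0 < g x) G"
  shows "((\<lambda>x. kite_angle D (f x) (g x)) \<longlongrightarrow> D) G"
proof -
  have "((\<lambda>x. D - vertex_arg D (f x / g x) - vertex_arg D (f x * g x)) \<longlongrightarrow>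
      D - vertex_arg D (0 / b) - vertex_arg D (0 * b)) G"
    using f g by (intro tendsto_diff tendsto_vertex_arg tendsto_divide tendsto_mult tendsto_const) auto
  hence "((\<lambda>x. D - vertex_arg D (f x / g x) - vertex_arg D (f x * g x)) \<longlongrightarrow> D) G"
    using D by (simp add: vertex_arg_0)
  thus ?thesis
  proof (rule Lim_transform_eventually)
    show "\<forall>\<^sub>F x in G. D - vertex_arg D (f x / g x) - vertex_arg D (f x * g x) = kite_angle D (f x) (g x)"
      using ev
    proof eventually_elim
      case (elim x)
      thus ?case using vertex_arg_inverse[of "f x / g x" D] by (simp add: kite_angle_def)
    qed
  qed
qed

text \<open>Each angle alone depends on the quotient of the radii and need not converge; the sum
  depends on their product only.\<close>

lemma tendsto_kite_angle_add_0:
  assumes D: "0 < D" "D < pi" and f: "(f \<longlongrightarrow> 0) G" and g: "(g \<longlongrightarrow> 0) G"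
    and ev: "eventually (\<lambda>x. 0 < f x \<and> 0 < g x) G"
  shows "((\<lambda>x. kite_angle D (f x) (g x) + kite_angle D (g x) (f x)) \<longlongrightarrow> D) G"
proof -
  have "((\<lambda>x. D - 2 * vertex_arg D (f x * g x)) \<longlongrightarrow> D - 2 * vertex_arg D (0 * 0)) G"
    using f g by (intro tendsto_diff tendsto_vertex_arg tendsto_mult tendsto_const) auto
  hence "((\<lambda>x. D - 2 * vertex_arg D (f x * g x)) \<longlongrightarrow> D) G"
    using D by (simp add: vertex_arg_0)
  thus ?thesis
    by (rule Lim_transform_eventually)
       (use ev in eventually_elim, auto simp: kite_angle_add)
qed

section \<open>Existence and uniqueness of the radii\<close>

text \<open>From here on only the finite incidence structure of faces and edges matters. The unknown
  \<open>a\<close> stands for \<open>tanh (r / 2)\<close>, with values between \<open>0\<close> and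
  \<open>1\<close>.\<close>

locale circle_pattern_problem =
  fixes F :: "'f set" and E :: "'e set" and adj :: "'e \<Rightarrow> 'f \<Rightarrow> bool" and opp :: "'f \<Rightarrow> 'e \<Rightarrow> 'f"
    and D :: "'e \<Rightarrow> real" and \<Phi> :: "'f \<Rightarrow> real"
  assumes finite_F: "finite F" and finite_E: "finite E"
    and D: "\<And>e. e \<in> E \<Longrightarrow> 0 < D e \<and> D e < pi" and \<Phi>: "\<And>f. f \<in> F \<Longrightarrow> 0 < \<Phi> f"
    and opp: "\<And>e f. \<lbrakk>e \<in> E; f \<in> F; adj e f\<rbrakk> \<Longrightarrow> opp f e \<in> F \<and> adj e (opp f e)"
    and adj_cases: "\<And>e f g. \<lbrakk>e \<in> E; f \<in> F; adj e f; g \<in> F; adj e g\<rbrakk> \<Longrightarrow> g = f \<or> g = opp f e"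
begin

definition mult :: "'f \<Rightarrow> 'e \<Rightarrow> real" where
  "mult f e = (if opp f e = f then 2 else 1)"

definition cone :: "('f \<Rightarrow> real) \<Rightarrow> 'f \<Rightarrow> real" where
  "cone a f = (\<Sum>e | e \<in> E \<and> adj e f. mult f e * (2 * kite_angle (D e) (a f) (a (opp f e))))"

definition adj_edges :: "'f set \<Rightarrow> 'e set" where
  "adj_edges X = {e\<in>E. \<exists>f\<in>X. adj e f}"

text \<open>The contribution of one edge to half the total cone angle of \<open>X\<close>; the
  condition of the theorem compares it with \<open>D e\<close>.\<close>

definition edge_sum :: "('f \<Rightarrow> real) \<Rightarrow> 'f set \<Rightarrow> 'e \<Rightarrow> real" where
  "edge_sum a X e = (\<Sum>f | f \<in> X \<and> adj e f. mult f e * kite_angle (D e) (a f) (a (opp f e)))"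

definition admissible :: "('f \<Rightarrow> real) \<Rightarrow> bool" where
  "admissible a \<longleftrightarrow> (\<forall>f\<in>F. 0 < a f \<and> a f < 1)"

lemma mult_pos: "mult f e > 0" by (simp add: mult_def)

lemma opp_opp:
  assumes "e \<in> E" "f \<in> F" "adj e f" shows "opp (opp f e) e = f"
  using assms opp adj_cases by metis

text \<open>Double counting of the incident pairs of faces in \<open>X\<close> and edges.\<close>

lemma sum_cone:
  assumes X: "X \<subseteq> F"
  shows "(\<Sum>f\<in>X. 1/2 * cone a f) = (\<Sum>e\<in>adj_edges X. edge_sum a X e)"
proof -
  have fX: "finite X" using X finite_F finite_subset by blast
  let ?g = "\<lambda>f e. mult f e * kite_angle (D e) (a f) (a (opp f e))"
  have "(\<Sum>f\<in>X. 1/2 * cone a f) = (\<Sum>f\<in>X. \<Sum>e | e \<in> E \<and> adj e f. ?g f e)"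
    by (simp add: cone_def sum_distrib_left)
  also have "\<dots> = (\<Sum>f\<in>X. \<Sum>e | e \<in> adj_edges X \<and> adj e f. ?g f e)"
    by (intro sum.cong) (auto simp: adj_edges_def)
  also have "\<dots> = (\<Sum>e\<in>adj_edges X. \<Sum>f | f \<in> X \<and> adj e f. ?g f e)"
    by (rule sum.swap_restrict) (use fX finite_E in \<open>auto simp: adj_edges_def\<close>)
  finally show ?thesis by (simp add: edge_sum_def)
qed

text \<open>The cases are: one face on both sides, two different faces of \<open>X\<close>, and a
  single side in \<open>X\<close>. In the first two the result has the shape of
  \<open>kite_angle_add\<close>; in the first, the multiplicity \<open>2\<close> supplies the second
  summand.\<close>

lemma edge_sum_eq:
  assumes "e \<in> E" "f \<in> X" "X \<subseteq> F" "adj e f"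
  shows "opp f e = f \<Longrightarrow> edge_sum a X e = kite_angle (D e) (a f) (a f) + kite_angle (D e) (a f) (a f)"
    "opp f e \<noteq> f \<Longrightarrow> opp f e \<in> X \<Longrightarrow>
      edge_sum a X e = kite_angle (D e) (a f) (a (opp f e)) + kite_angle (D e) (a (opp f e)) (a f)"
    "opp f e \<notin> X \<Longrightarrow> edge_sum a X e = kite_angle (D e) (a f) (a (opp f e))"
proof -
  have f: "f \<in> F" using assms by auto
  have sub: "{g. g \<in> X \<and> adj e g} \<subseteq> {f, opp f e}" "f \<in> {g. g \<in> X \<and> adj e g}"
    using adj_cases[OF assms(1) f assms(4)] assms by auto
  have o: "opp f e \<in> F" "adj e (opp f e)" using opp assms f by auto
  {
    assume "opp f e = f"
    moreover from this have "{g. g \<in> X \<and> adj e g} = {f}" using sub by auto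
    ultimately show "edge_sum a X e = kite_angle (D e) (a f) (a f) + kite_angle (D e) (a f) (a f)"
      by (simp add: edge_sum_def mult_def)
  next
    assume "opp f e \<noteq> f" "opp f e \<in> X"
    moreover from this have "{g. g \<in> X \<and> adj e g} = {f, opp f e}" using sub o by auto
    ultimately show "edge_sum a X e = kite_angle (D e) (a f) (a (opp f e)) + kite_angle (D e) (a (opp f e)) (a f)"
      using opp_opp[OF assms(1) f assms(4)] by (simp add: edge_sum_def mult_def)
  next
    assume "opp f e \<notin> X"
    moreover from this have "{g. g \<in> X \<and> adj e g} = {f}" using sub by auto
    ultimately show "edge_sum a X e = kite_angle (D e) (a f) (a (opp f e))"
      using assms by (auto simp: edge_sum_def mult_def)
  }
qed

lemma edge_sum_less:
  assumes a: "admissible a" and X: "X \<subseteq> F" and e: "e \<in> adj_edges X"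
  shows "edge_sum a X e < D e"
proof -
  obtain f where f: "e \<in> E" "f \<in> X" "adj e f" "f \<in> F"
    using e X unfolding adj_edges_def by blast
  have o: "opp f e \<in> F" using opp f by auto
  have ab: "0 < a f" "a f < 1" "0 < a (opp f e)" using a f o by (auto simp: admissible_def)
  note De = D[OF f(1)]
  have add: "kite_angle (D e) (a f) b + kite_angle (D e) b (a f) < D e" if "b > 0" for b
    using kite_angle_add[of "a f" b "D e"] vertex_arg_bounds[of "D e" "a f * b"] ab that De by simp
  show ?thesis
    using edge_sum_eq[OF f(1,2) X f(3), of a] add[OF ab(1)] add[OF ab(3)]
      kite_angle_bounds(2)[of "D e" "a f" "a (opp f e)"] ab De
    by metis
qed

section \<open>Necessity of the condition\<close>

lemma angle_condition_necessary:
  assumes a: "admissible a" and cone: "\<And>f. f \<in> F \<Longrightarrow> cone a f = \<Phi> f" and X: "X \<subseteq> F" "X \<noteq> {}"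
  shows "(\<Sum>f\<in>X. 1/2 * \<Phi> f) < (\<Sum>e\<in>adj_edges X. D e)"
proof -
  obtain f where f: "f \<in> X" "f \<in> F" using X by blast
  \<comment> \<open>A face without edges would have cone angle \<open>0\<close>. An edge is needed
    for the sum of strict inequalities to be strict.\<close>
  have "{e \<in> E. adj e f} \<noteq> {}"
  proof
    assume "{e \<in> E. adj e f} = {}"
    hence "cone a f = 0" unfolding cone_def by (metis (no_types, lifting) sum.empty)
    thus False using cone[OF f(2)] \<Phi>[OF f(2)] by simp
  qed
  hence ne: "adj_edges X \<noteq> {}" using f by (auto simp: adj_edges_def)
  have "(\<Sum>f\<in>X. 1/2 * \<Phi> f) = (\<Sum>f\<in>X. 1/2 * cone a f)"
    using cone X by (intro sum.cong) auto
  also have "\<dots> = (\<Sum>e\<in>adj_edges X. edge_sum a X e)" by (rule sum_cone[OF X(1)])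
  also have "\<dots> < (\<Sum>e\<in>adj_edges X. D e)"
    using ne finite_E edge_sum_less[OF a X(1)]
    by (intro sum_strict_mono) (auto simp: adj_edges_def)
  finally show ?thesis .
qed

section \<open>Uniqueness by a maximum principle\<close>

text \<open>At a face where the ratio \<open>a' f / a f\<close> is maximal and exceeds \<open>1\<close>, the cone angle of \<open>a'\<close>
  would be smaller than that of \<open>a\<close>, because scaling both radii up decreases the angle.\<close>

lemma cone_eq_imp_le:
  assumes a: "admissible a" and a': "admissible a'"
    and cone: "\<And>f. f \<in> F \<Longrightarrow> cone a f = \<Phi> f" "\<And>f. f \<in> F \<Longrightarrow> cone a' f = \<Phi> f" and f: "f \<in> F"
  shows "a' f \<le> a f"
proof (rule ccontr)
  assume "\<not> a' f \<le> a f"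
  have ap: "0 < a g" "a g < 1" "0 < a' g" "a' g < 1" if "g \<in> F" for g
    using a a' that by (auto simp: admissible_def)
  define l where "l = Max ((\<lambda>g. a' g / a g) ` F)"
  have le: "a' g / a g \<le> l" if "g \<in> F" for g
    unfolding l_def using finite_F that by simp
  have "l \<in> (\<lambda>g. a' g / a g) ` F"
    unfolding l_def using finite_F f by (intro Max_in) auto
  then obtain h where h: "h \<in> F" "l = a' h / a h" by blast
  have "1 < a' f / a f" using \<open>\<not> a' f \<le> a f\<close> ap[OF f] by simp
  hence l: "1 < l" using le[OF f] by simp
  have less: "kite_angle (D e) (a' h) (a' (opp h e)) < kite_angle (D e) (a h) (a (opp h e))"
    if e: "e \<in> E" "adj e h" for e
  proof -
    have o: "opp h e \<in> F" using opp e h by auto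
    have "a' (opp h e) \<le> l * a (opp h e)" using le[OF o] ap[OF o] by (simp add: field_simps)
    \<comment> \<open>The neighbour is divided by \<open>l\<close> instead of multiplied, since
      \<open>l * a (opp h e)\<close> could leave the range where the angle is monotone.\<close>
    hence q: "a' (opp h e) / l \<le> a (opp h e)" using l by (simp add: field_simps)
    have "a' h = l * a h" "a' (opp h e) = l * (a' (opp h e) / l)" using h ap[OF h(1)] l by auto
    hence "kite_angle (D e) (a' h) (a' (opp h e)) = kite_angle (D e) (l * a h) (l * (a' (opp h e) / l))"
      by simp
    also have "\<dots> < kite_angle (D e) (a h) (a' (opp h e) / l)"
      using D[OF e(1)] ap[OF h(1)] ap[OF o] l by (intro kite_angle_scale) auto
    also have "\<dots> \<le> kite_angle (D e) (a h) (a (opp h e))"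
      using D[OF e(1)] ap[OF h(1)] ap[OF o] l q by (intro kite_angle_mono) auto
    finally show ?thesis .
  qed
  have "{e \<in> E. adj e h} \<noteq> {}"
  proof
    assume "{e \<in> E. adj e h} = {}"
    hence "cone a h = 0" unfolding cone_def by (metis (no_types, lifting) sum.empty)
    thus False using cone(1)[OF h(1)] \<Phi>[OF h(1)] by simp
  qed
  hence "cone a' h < cone a h"
    unfolding cone_def using finite_E less mult_pos by (intro sum_strict_mono) auto
  thus False using cone h by simp
qed

section \<open>Existence by Perron's method\<close>

definition supersolution :: "('f \<Rightarrow> real) \<Rightarrow> bool" where
  "supersolution a \<longleftrightarrow> admissible a \<and> (\<forall>f\<in>F. cone a f \<le> \<Phi> f)"

lemma tendsto_cone:
  assumes "\<And>g. g \<in> F \<Longrightarrow> ((\<lambda>x. a x g) \<longlongrightarrow> b g) G" "\<And>g. g \<in> F \<Longrightarrow> 0 < b g" "f \<in> F"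
  shows "((\<lambda>x. cone (a x) f) \<longlongrightarrow> cone b f) G"
  unfolding cone_def
  by (intro tendsto_sum tendsto_mult tendsto_const tendsto_kite_angle) (use assms opp in auto)

lemma cone_mono:
  assumes "admissible a" "admissible b" "f \<in> F" "a f = b f" "\<And>g. g \<in> F \<Longrightarrow> a g \<le> b g"
  shows "cone a f \<le> cone b f"
  unfolding cone_def
proof (rule sum_mono)
  fix e assume e: "e \<in> {e \<in> E. adj e f}"
  have o: "opp f e \<in> F" using opp e assms(3) by auto
  have "kite_angle (D e) (a f) (a (opp f e)) \<le> kite_angle (D e) (a f) (b (opp f e))"
    using e assms o D[of e] by (intro kite_angle_mono) (auto simp: admissible_def less_imp_le)
  thus "mult f e * (2 * kite_angle (D e) (a f) (a (opp f e)))
      \<le> mult f e * (2 * kite_angle (D e) (b f) (b (opp f e)))"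
    using assms(4) mult_pos[of f e] by simp
qed

text \<open>For the constant \<open>1\<close> all angles vanish, because quotient and product agree.
  By continuity a constant slightly below \<open>1\<close> has cone angles below \<Phi>.\<close>

lemma supersolution_exists: "\<exists>a. supersolution a"
proof -
  have c0: "cone (\<lambda>_. 1) f = 0" for f by (simp add: cone_def kite_angle_def)
  have "\<forall>\<^sub>F t in at_left 1. cone (\<lambda>_. t) f < \<Phi> f" if f: "f \<in> F" for f
  proof -
    have "((\<lambda>t. cone (\<lambda>_. t) f) \<longlongrightarrow> cone (\<lambda>_. 1) f) (at_left 1)"
      by (rule tendsto_cone) (use f in auto)
    thus ?thesis unfolding c0 using \<Phi>[OF f] by (rule order_tendstoD)
  qed
  hence "\<forall>\<^sub>F t in at_left 1. \<forall>f\<in>F. cone (\<lambda>_. t) f < \<Phi> f"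
    using finite_F by (simp add: eventually_ball_finite)
  moreover have "\<forall>\<^sub>F t in at_left (1::real). t \<in> {0<..<1}"
    by (rule eventually_at_left_real) simp
  ultimately have "\<forall>\<^sub>F t in at_left 1. supersolution (\<lambda>_. t)"
    by eventually_elim (auto simp: supersolution_def admissible_def less_imp_le)
  thus ?thesis using eventually_happens'[OF trivial_limit_at_left_real[of 1]] by blast
qed

text \<open>At each face the minimum is attained by some \<open>b i\<close>; the neighbours are no
  larger than in \<open>b i\<close>, so \<open>cone_mono\<close> bounds the cone angle
  there.\<close>

lemma supersolution_Min:
  assumes I: "finite I" "I \<noteq> {}" and b: "\<And>i. i \<in> I \<Longrightarrow> supersolution (b i)"
  shows "supersolution (\<lambda>f. Min ((\<lambda>i. b i f) ` I))" (is "supersolution ?a")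
proof -
  have le: "?a f \<le> b i f" if "i \<in> I" for i f using I that by simp
  have at: "\<exists>i\<in>I. ?a f = b i f" for f
  proof -
    have "?a f \<in> (\<lambda>i. b i f) ` I" using I by (intro Min_in) auto
    thus ?thesis by blast
  qed
  have adm: "admissible ?a"
    unfolding admissible_def
  proof
    fix f assume "f \<in> F"
    moreover obtain i where "i \<in> I" "?a f = b i f" using at by blast
    ultimately show "0 < ?a f \<and> ?a f < 1" using b by (simp add: supersolution_def admissible_def)
  qed
  moreover have "cone ?a f \<le> \<Phi> f" if f: "f \<in> F" for f
  proof -
    obtain i where i: "i \<in> I" "?a f = b i f" using at by blast
    have "cone ?a f \<le> cone (b i) f"
      using cone_mono[of ?a "b i"] adm b[OF i(1)] f i le by (simp add: supersolution_def)
    thus ?thesis using b[OF i(1)] f by (force simp: supersolution_def)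
  qed
  ultimately show ?thesis by (simp add: supersolution_def)
qed

definition inf_supersolution :: "'f \<Rightarrow> real" where
  "inf_supersolution f = Inf ((\<lambda>a. a f) ` Collect supersolution)"

lemma inf_supersolution_le:
  assumes "supersolution a" "f \<in> F" shows "inf_supersolution f \<le> a f"
  unfolding inf_supersolution_def
proof (rule cInf_lower)
  show "bdd_below ((\<lambda>a. a f) ` Collect supersolution)"
    by (rule bdd_belowI[of _ 0]) (use assms in \<open>auto simp: supersolution_def admissible_def less_imp_le\<close>)
qed (use assms in auto)

lemma inf_supersolution_nonneg:
  assumes "f \<in> F" shows "0 \<le> inf_supersolution f"
  unfolding inf_supersolution_def
  by (rule cInf_greatest)
     (use assms supersolution_exists in \<open>auto simp: supersolution_def admissible_def less_imp_le\<close>)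

text \<open>The infimum is taken at each face separately. The minimum of one nearly optimal
  supersolution per face is close to it at all faces at once.\<close>

lemma supersolution_near_inf:
  assumes "0 < \<epsilon>"
  shows "\<exists>a. supersolution a \<and> (\<forall>f\<in>F. a f < inf_supersolution f + \<epsilon>)"
proof (cases "F = {}")
  case True
  thus ?thesis using supersolution_exists by auto
next
  case False
  have "\<exists>b. supersolution b \<and> b f < inf_supersolution f + \<epsilon>" for f
  proof -
    have "Inf ((\<lambda>a. a f) ` Collect supersolution) < inf_supersolution f + \<epsilon>"
      using assms by (simp add: inf_supersolution_def)
    from cInf_lessD[OF _ this] show ?thesis using supersolution_exists by auto
  qed
  then obtain b where b: "\<And>f. supersolution (b f)" "\<And>f. b f f < inf_supersolution f + \<epsilon>" by metis
  have "Min ((\<lambda>i. b i f) ` F) < inf_supersolution f + \<epsilon>" if "f \<in> F" for f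
    by (rule le_less_trans[OF Min_le b(2)]) (use finite_F that in auto)
  thus ?thesis using supersolution_Min[OF finite_F False, of b] b(1) by blast
qed

lemma supersolution_sequence:
  obtains A where "\<And>n. supersolution (A n)"
    "\<And>f. f \<in> F \<Longrightarrow> (\<lambda>n. A n f) \<longlonglongrightarrow> inf_supersolution f"
proof -
  have "\<exists>a. supersolution a \<and> (\<forall>f\<in>F. a f < inf_supersolution f + inverse (real (Suc n)))" for n
    by (rule supersolution_near_inf) simp
  then obtain A where A: "\<And>n. supersolution (A n)"
    "\<And>n f. f \<in> F \<Longrightarrow> A n f < inf_supersolution f + inverse (real (Suc n))" by metis
  have "(\<lambda>n. A n f) \<longlonglongrightarrow> inf_supersolution f" if f: "f \<in> F" for f
  proof (rule tendsto_sandwich[where f = "\<lambda>_. inf_supersolution f"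
        and h = "\<lambda>n. inf_supersolution f + inverse (real (Suc n))"])
    show "(\<lambda>n. inf_supersolution f + inverse (real (Suc n))) \<longlonglongrightarrow> inf_supersolution f"
      by (rule LIMSEQ_inverse_real_of_nat_add)
    show "(\<lambda>_. inf_supersolution f) \<longlonglongrightarrow> inf_supersolution f" by simp
  qed (use A(1) A(2)[OF f] inf_supersolution_le[OF _ f] in \<open>simp_all add: less_imp_le\<close>)
  thus ?thesis using that A by blast
qed

text \<open>Continuity gives cone angles at most \<Phi>. Where the inequality is strict, the value
  at that face could be lowered a little, giving a supersolution below the infimum.\<close>

lemma cone_inf_supersolution:
  assumes pos: "\<And>f. f \<in> F \<Longrightarrow> 0 < inf_supersolution f"
  shows "admissible inf_supersolution" "\<And>f. f \<in> F \<Longrightarrow> cone inf_supersolution f = \<Phi> f"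
proof -
  let ?\<alpha> = inf_supersolution
  obtain A where A: "\<And>n. supersolution (A n)" "\<And>f. f \<in> F \<Longrightarrow> (\<lambda>n. A n f) \<longlonglongrightarrow> ?\<alpha> f"
    using supersolution_sequence by blast
  have lt1: "?\<alpha> f < 1" if "f \<in> F" for f
  proof -
    have "A 0 f < 1" using A(1)[of 0] that by (simp add: supersolution_def admissible_def)
    thus ?thesis using inf_supersolution_le[OF A(1)[of 0] that] by simp
  qed
  show adm: "admissible ?\<alpha>" using pos lt1 by (auto simp: admissible_def)
  have le: "cone ?\<alpha> f \<le> \<Phi> f" if f: "f \<in> F" for f
  proof (rule LIMSEQ_le_const2)
    show "(\<lambda>n. cone (A n) f) \<longlonglongrightarrow> cone ?\<alpha> f" by (rule tendsto_cone) (use A pos f in auto)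
    show "\<exists>N. \<forall>n\<ge>N. cone (A n) f \<le> \<Phi> f" using A(1) f by (auto simp: supersolution_def)
  qed
  fix f assume f: "f \<in> F"
  show "cone ?\<alpha> f = \<Phi> f"
  proof (rule ccontr)
    assume "cone ?\<alpha> f \<noteq> \<Phi> f"
    hence less: "cone ?\<alpha> f < \<Phi> f" using le[OF f] by simp
    have "((\<lambda>t. cone (?\<alpha>(f := t)) f) \<longlongrightarrow> cone ?\<alpha> f) (at_left (?\<alpha> f))"
    proof (rule tendsto_cone)
      fix g assume "g \<in> F"
      show "((\<lambda>t. (?\<alpha>(f := t)) g) \<longlongrightarrow> ?\<alpha> g) (at_left (?\<alpha> f))"
        by (cases "g = f") auto
    qed (use pos f in auto)
    hence "\<forall>\<^sub>F t in at_left (?\<alpha> f). cone (?\<alpha>(f := t)) f < \<Phi> f"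
      using less by (rule order_tendstoD)
    moreover have "\<forall>\<^sub>F t in at_left (?\<alpha> f). t \<in> {0<..<?\<alpha> f}"
      by (rule eventually_at_left_real) (rule pos[OF f])
    ultimately have "\<forall>\<^sub>F t in at_left (?\<alpha> f). cone (?\<alpha>(f := t)) f < \<Phi> f \<and> t \<in> {0<..<?\<alpha> f}"
      by (rule eventually_conj)
    from eventually_happens'[OF trivial_limit_at_left_real this]
    obtain t where t: "cone (?\<alpha>(f := t)) f < \<Phi> f" "0 < t" "t < ?\<alpha> f" by auto
    have adm': "admissible (?\<alpha>(f := t))"
      using adm t lt1[OF f] by (auto simp: admissible_def)
    have "cone (?\<alpha>(f := t)) g \<le> \<Phi> g" if g: "g \<in> F" for g
    proof (cases "g = f")
      case False
      have "cone (?\<alpha>(f := t)) g \<le> cone ?\<alpha> g"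
        by (rule cone_mono[OF adm' adm g]) (use False t in auto)
      thus ?thesis using le[OF g] by simp
    qed (use t in simp)
    hence "supersolution (?\<alpha>(f := t))" using adm' by (simp add: supersolution_def)
    from inf_supersolution_le[OF this f] show False using t by simp
  qed
qed

text \<open>On the zero set \<open>X\<close> of the infimum the edge sums of an approximating
  sequence tend to \<open>D e\<close>. Summed over the edges of \<open>X\<close> they are at most
  half the sum of \<Phi>, so the limit contradicts the condition for \<open>X\<close>.\<close>

lemma inf_supersolution_pos:
  assumes cond: "\<And>X. X \<subseteq> F \<Longrightarrow> X \<noteq> {} \<Longrightarrow> (\<Sum>f\<in>X. 1/2 * \<Phi> f) < (\<Sum>e\<in>adj_edges X. D e)"
    and f: "f \<in> F"
  shows "0 < inf_supersolution f"
proof (rule ccontr)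
  let ?\<alpha> = inf_supersolution
  assume "\<not> 0 < ?\<alpha> f"
  define X where "X = {g\<in>F. ?\<alpha> g = 0}"
  have X: "X \<subseteq> F" "f \<in> X" "X \<noteq> {}"
    using f \<open>\<not> 0 < ?\<alpha> f\<close> inf_supersolution_nonneg[OF f] by (auto simp: X_def)
  obtain A where A: "\<And>n. supersolution (A n)" "\<And>f. f \<in> F \<Longrightarrow> (\<lambda>n. A n f) \<longlonglongrightarrow> ?\<alpha> f"
    using supersolution_sequence by blast
  have Apos: "0 < A n g" if "g \<in> F" for n g
    using A(1)[of n] that by (simp add: supersolution_def admissible_def)
  have lim: "(\<lambda>n. edge_sum (A n) X e) \<longlonglongrightarrow> D e" if e: "e \<in> adj_edges X" for e
  proof -
    obtain g where g: "e \<in> E" "g \<in> X" "adj e g" "g \<in> F"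
      using e X(1) unfolding adj_edges_def by blast
    have o: "opp g e \<in> F" using opp g by auto
    have De: "0 < D e" "D e < pi" using D[OF g(1)] by auto
    have lg: "(\<lambda>n. A n h) \<longlonglongrightarrow> 0" if "h \<in> X" for h
      using A(2)[of h] that by (simp add: X_def)
    note eq = edge_sum_eq[OF g(1,2) X(1) g(3)]
    have ev: "\<forall>\<^sub>F n in sequentially. 0 < A n g \<and> 0 < A n h" if "h \<in> F" for h
      using Apos g that by simp
    consider "opp g e = g" | "opp g e \<noteq> g" "opp g e \<in> X" | "opp g e \<notin> X" by blast
    thus ?thesis
    proof cases
      case 1
      show ?thesis unfolding eq(1)[OF 1]
        by (rule tendsto_kite_angle_add_0[OF De lg[OF g(2)] lg[OF g(2)] ev[OF g(4)]])
    next
      case 2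
      show ?thesis unfolding eq(2)[OF 2]
        by (rule tendsto_kite_angle_add_0[OF De lg[OF g(2)] lg[OF 2(2)] ev[OF o]])
    next
      case 3
      \<comment> \<open>The neighbour keeps a positive limit while the value at \<open>g\<close>
        vanishes, so the single angle at \<open>g\<close> already tends to
        \<open>D e\<close>.\<close>
      have "0 < ?\<alpha> (opp g e)" using 3 o inf_supersolution_nonneg[OF o] by (auto simp: X_def)
      thus ?thesis unfolding eq(3)[OF 3]
        by (intro tendsto_kite_angle_left_0[OF De lg[OF g(2)] A(2)[OF o] _ ev[OF o]])
    qed
  qed
  have "(\<Sum>e\<in>adj_edges X. D e) \<le> (\<Sum>f\<in>X. 1/2 * \<Phi> f)"
  proof (rule LIMSEQ_le_const2)
    show "(\<lambda>n. \<Sum>e\<in>adj_edges X. edge_sum (A n) X e) \<longlonglongrightarrow> (\<Sum>e\<in>adj_edges X. D e)"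
      by (intro tendsto_sum lim)
    have "(\<Sum>f\<in>X. 1/2 * cone (A n) f) \<le> (\<Sum>f\<in>X. 1/2 * \<Phi> f)" for n
      using A(1)[of n] X(1) by (intro sum_mono) (auto simp: supersolution_def)
    thus "\<exists>N. \<forall>n\<ge>N. (\<Sum>e\<in>adj_edges X. edge_sum (A n) X e) \<le> (\<Sum>f\<in>X. 1/2 * \<Phi> f)"
      unfolding sum_cone[OF X(1)] by blast
  qed
  thus False using cond[OF X(1,3)] by simp
qed

end

section \<open>Translation back to radii on the surface\<close>

lemma tanh_artanh_real:
  assumes "\<bar>x\<bar> < 1" shows "tanh (artanh x) = (x::real)"
proof -
  have x: "0 < 1 + x" "0 < 1 - x" using assms by auto
  have "exp (- (2 * artanh x)) = (1 - x) / (1 + x)"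
    using x by (simp add: artanh_def exp_minus)
  moreover have "1 - (1 - x) / (1 + x) = 2 * x / (1 + x)" "1 + (1 - x) / (1 + x) = 2 / (1 + x)"
    using x by (simp_all add: field_simps)
  ultimately show ?thesis using x by (simp add: tanh_real_altdef)
qed

theorem theorem1p2:
  fixes S :: "'a topology" and V :: "'a set" and E F :: "'a set set"
    and D \<Phi> :: "'a set \<Rightarrow> real"
  assumes "closed_connected_surface S"
    and "cell_decomposition S V E F"
    and "D \<in> E \<rightarrow> {0<..<pi}"
    and "\<Phi> \<in> F \<rightarrow> {0<..}"
  shows "(\<exists>!r. circle_pattern_radii S E F D \<Phi> r) \<longleftrightarrow>
    (\<forall>X. X \<subseteq> F \<and> X \<noteq> {} \<longrightarrow>
       (\<Sum>f\<in>X. 1/2 * \<Phi> f) < (\<Sum>e\<in>edges_of_faces S E X. D e))"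
proof -
  note opposite = opposite_face_properties[OF assms(1,2)]
  interpret P: circle_pattern_problem F E "is_edge_of S" "opposite_face S F" D \<Phi>
  proof
    show "finite F" "finite E" using cell_decompositionD[OF assms(2)] by auto
    show "0 < D e \<and> D e < pi" if "e \<in> E" for e using assms(3) that by auto
    show "0 < \<Phi> f" if "f \<in> F" for f using assms(4) that by auto
    show "opposite_face S F f e \<in> F \<and> is_edge_of S e (opposite_face S F f e)"
      if "e \<in> E" "f \<in> F" "is_edge_of S e f" for e f using opposite that by blast
    show "g = f \<or> g = opposite_face S F f e"
      if "e \<in> E" "f \<in> F" "is_edge_of S e f" "g \<in> F" "is_edge_of S e g" for e f g
      using opposite(3) that by blast
  qed
  have edges: "P.adj_edges X = edges_of_faces S E X" for X
    by (simp add: P.adj_edges_def edges_of_faces_def)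
  define a where "a r f = tanh (r f / 2)" for r :: "'a set \<Rightarrow> real" and f
  have adm: "P.admissible (a r)" if "r \<in> F \<rightarrow>\<^sub>E {0<..}" for r
    unfolding P.admissible_def
  proof
    fix f assume "f \<in> F"
    hence "0 < r f" using that by (auto simp: PiE_def)
    thus "0 < a r f \<and> a r f < 1" by (simp add: a_def tanh_real_lt_1)
  qed
  have cone: "cone_angle S E F D r f = P.cone (a r) f" if "r \<in> F \<rightarrow>\<^sub>E {0<..}" "f \<in> F" for r f
    unfolding cone_angle_def P.cone_def
  proof (rule sum.cong[OF refl])
    fix e assume e: "e \<in> {e \<in> E. is_edge_of S e f}"
    have "opposite_face S F f e \<in> F" using opposite(1) e that by blast
    hence "0 < r f" "0 < r (opposite_face S F f e)" using that by (auto simp: PiE_def)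
    hence "pattern_angle S F D r f e = kite_angle (D e) (a r f) (a r (opposite_face S F f e))"
      unfolding pattern_angle_def a_def using P.D[of e] e by (intro triangle_angle_kite) auto
    thus "real (edge_multiplicity S F f e) * (2 * pattern_angle S F D r f e)
        = P.mult f e * (2 * kite_angle (D e) (a r f) (a r (opposite_face S F f e)))"
      by (simp add: edge_multiplicity_def P.mult_def)
  qed
  have radii: "circle_pattern_radii S E F D \<Phi> r \<longleftrightarrow>
      r \<in> F \<rightarrow>\<^sub>E {0<..} \<and> (\<forall>f\<in>F. P.cone (a r) f = \<Phi> f)" for r
    unfolding circle_pattern_radii_def using cone by auto
  show ?thesis
  proof
    assume "\<exists>!r. circle_pattern_radii S E F D \<Phi> r"
    then obtain r where "r \<in> F \<rightarrow>\<^sub>E {0<..}" "\<And>f. f \<in> F \<Longrightarrow> P.cone (a r) f = \<Phi> f"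
      unfolding radii by blast
    thus "\<forall>X. X \<subseteq> F \<and> X \<noteq> {} \<longrightarrow>
       (\<Sum>f\<in>X. 1/2 * \<Phi> f) < (\<Sum>e\<in>edges_of_faces S E X. D e)"
      using P.angle_condition_necessary[OF adm] edges by metis
  next
    assume cond: "\<forall>X. X \<subseteq> F \<and> X \<noteq> {} \<longrightarrow>
       (\<Sum>f\<in>X. 1/2 * \<Phi> f) < (\<Sum>e\<in>edges_of_faces S E X. D e)"
    define \<alpha> where "\<alpha> = P.inf_supersolution"
    have pos: "0 < P.inf_supersolution f" if "f \<in> F" for f
      by (rule P.inf_supersolution_pos[OF _ that]) (use cond edges in auto)
    have \<alpha>: "P.admissible \<alpha>" "\<And>f. f \<in> F \<Longrightarrow> P.cone \<alpha> f = \<Phi> f"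
      unfolding \<alpha>_def using P.cone_inf_supersolution pos by auto
    have \<alpha>01: "0 < \<alpha> f" "\<alpha> f < 1" if "f \<in> F" for f
      using \<alpha>(1) that by (auto simp: P.admissible_def)
    \<comment> \<open>The inverse of \<open>a\<close>, restricted to \<open>F\<close> because radius
      functions are extensional.\<close>
    define r where "r = restrict (\<lambda>f. 2 * artanh (\<alpha> f)) F"
    have ar: "a r f = \<alpha> f" if "f \<in> F" for f
      using \<alpha>01[OF that] that by (simp add: a_def r_def tanh_artanh_real)
    have r: "r \<in> F \<rightarrow>\<^sub>E {0<..}"
    proof
      fix f assume f: "f \<in> F"
      have "0 < tanh (r f / 2)" using ar[OF f] \<alpha>01[OF f] by (simp add: a_def)
      thus "r f \<in> {0<..}" by simp
    qed (simp add: r_def)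
    \<comment> \<open>Outside \<open>F\<close> the functions may differ, but the cone angle of a
      face reads only values on \<open>F\<close>, as opposite faces lie in \<open>F\<close>.\<close>
    have "P.cone (a r) f = P.cone \<alpha> f" if "f \<in> F" for f
      unfolding P.cone_def using ar that opposite(1) by (intro sum.cong) auto
    hence "circle_pattern_radii S E F D \<Phi> r" using r \<alpha>(2) by (simp add: radii)
    moreover have "s = t"
      if "circle_pattern_radii S E F D \<Phi> s" "circle_pattern_radii S E F D \<Phi> t" for s t
    proof -
      have st: "s \<in> F \<rightarrow>\<^sub>E {0<..}" "t \<in> F \<rightarrow>\<^sub>E {0<..}" using that by (auto simp: radii)
      have "a s f = a t f" if "f \<in> F" for f
        using P.cone_eq_imp_le[OF adm[OF st(1)] adm[OF st(2)] _ _ that]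
          P.cone_eq_imp_le[OF adm[OF st(2)] adm[OF st(1)] _ _ that]
          \<open>circle_pattern_radii S E F D \<Phi> s\<close> \<open>circle_pattern_radii S E F D \<Phi> t\<close>
        by (auto simp: radii intro!: antisym)
      thus ?thesis using st by (intro PiE_ext) (auto simp: a_def)
    qed
    ultimately show "\<exists>!r. circle_pattern_radii S E F D \<Phi> r" by blast
  qed
qed

end
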